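(* For every $n\geq 4$, the poset $\mathcal{S}_n$ is not a lattice.
   Context: All graphs are finite and simple. The chromatic symmetric function of a graph $G$ with vertices $v_1,\dots,v_n$ is $X_G=\sum_{\kappa}x_{\kappa(v_1)}\cdots x_{\kappa(v_n)}$, summed over all proper colorings $\kappa:V(G)\to\{1,2,3,\dots\}$; it is a homogeneous symmetric function of degree $n$ over $\mathbb{Q}$. Let $s_\lambda$ be the Schur symmetric functions; $[s_\lambda]F$ denotes the coefficient of $s_\lambda$ in $F$ expanded in this basis, and $F$ is Schur-positive if $[s_\lambda]F\ge 0$ for all $\lambda$. For connected graphs $G,H$ on $n$ vertices (for which $[s_{(1^n)}]X_G$ and $[s_{(1^n)}]X_H$ are positive), set $$X_s(G,H)=X_G-\frac{[s_{(1^n)}]X_G}{[s_{(1^n)}]X_H}X_H.$$ $\mathcal{S}_n$ is the poset whose elements are the equivalence classes of connected graphs on $n$ vertices under $G\sim H\iff X_G=X_H$, ordered by $G\geq_s H$ if and only if $X_s(G,H)$ is Schur-positive. *)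

theory Defs
  imports
    "HOL.Rat"
    "HOL-Library.Multiset"
    "HOL-Library.FuncSet"
    "HOL-Algebra.Lattice"
    "Graph_Theory.Pair_Digraph"
    "Graph_Theory.Digraph_Component"
begin

text \<open>
  A monomial \<open>x\<^sub>i x\<^sub>j x\<^sub>k \<dots>\<close> is the multiset \<open>{#i, j, k, \<dots>#}\<close> of the indices of its variables,
  and a series is given by its coefficients. Colours and tableau entries are positive, so the
  variable \<open>x\<^sub>0\<close> never occurs.
\<close>

type_synonym series = "nat multiset \<Rightarrow> rat"

text \<open>The monomial \<open>\<Prod>a\<in>A. x\<^bsub>f a\<^esub>\<close>, for finite \<open>A\<close>.\<close>

definition monomial_of :: "('a \<Rightarrow> nat) \<Rightarrow> 'a set \<Rightarrow> nat multiset" where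
  "monomial_of f A = image_mset f (mset_set A)"

text \<open>
  A finite simple graph is a \<^const>\<open>pair_graph\<close>: a finite vertex set with a symmetric, irreflexive
  set of ordered pairs as adjacency relation.
  Colourings are extensional outside the vertex set, so that each one is counted once.
\<close>

definition proper_colorings :: "'a pair_pre_digraph \<Rightarrow> ('a \<Rightarrow> nat) set" where
  "proper_colorings G =
    {\<kappa> \<in> pverts G \<rightarrow>\<^sub>E {1..}. \<forall>(u, v) \<in> parcs G. \<kappa> u \<noteq> \<kappa> v}"

definition chromatic_sf :: "'a pair_pre_digraph \<Rightarrow> series" where
  "chromatic_sf G =
    (\<lambda>m. of_nat (card {\<kappa> \<in> proper_colorings G. monomial_of \<kappa> (pverts G) = m}))"

definition is_partition :: "nat list \<Rightarrow> bool" where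
  "is_partition \<mu> \<longleftrightarrow> sorted_wrt (\<ge>) \<mu> \<and> 0 \<notin> set \<mu>"

definition young_diagram :: "nat list \<Rightarrow> (nat \<times> nat) set" where
  "young_diagram \<mu> = {(i, j). i < length \<mu> \<and> j < \<mu> ! i}"

definition ssyt :: "nat list \<Rightarrow> (nat \<times> nat \<Rightarrow> nat) set" where
  "ssyt \<mu> = {T \<in> young_diagram \<mu> \<rightarrow>\<^sub>E {1..}.
     (\<forall>i j j'. (i, j) \<in> young_diagram \<mu> \<and> (i, j') \<in> young_diagram \<mu> \<and> j < j' \<longrightarrow> T (i, j) \<le> T (i, j')) \<and>
     (\<forall>i i' j. (i, j) \<in> young_diagram \<mu> \<and> (i', j) \<in> young_diagram \<mu> \<and> i < i' \<longrightarrow> T (i, j) < T (i', j))}"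

definition schur :: "nat list \<Rightarrow> series" where
  "schur \<mu> = (\<lambda>m. of_nat (card {T \<in> ssyt \<mu>. monomial_of T (young_diagram \<mu>) = m}))"

definition schur_expansion :: "series \<Rightarrow> (nat list \<Rightarrow> rat) \<Rightarrow> bool" where
  "schur_expansion F c \<longleftrightarrow>
     finite {\<mu>. c \<mu> \<noteq> 0} \<and> (\<forall>\<mu>. c \<mu> \<noteq> 0 \<longrightarrow> is_partition \<mu>) \<and>
     F = (\<lambda>m. \<Sum>\<mu> | c \<mu> \<noteq> 0. c \<mu> * schur \<mu> m)"

text \<open>
  The coefficient \<open>[s\<^sub>\<mu>]F\<close>. As the Schur functions form a basis of the ring of symmetric functions,
  the expansion of a symmetric function of bounded degree exists and is unique.
\<close>

definition schur_coeff :: "nat list \<Rightarrow> series \<Rightarrow> rat" where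
  "schur_coeff \<mu> F = (THE c. schur_expansion F c) \<mu>"

definition schur_positive :: "series \<Rightarrow> bool" where
  "schur_positive F \<longleftrightarrow> (\<forall>\<mu>. is_partition \<mu> \<longrightarrow> schur_coeff \<mu> F \<ge> 0)"

definition X_s :: "nat \<Rightarrow> 'a pair_pre_digraph \<Rightarrow> 'a pair_pre_digraph \<Rightarrow> series" where
  "X_s n G H = (\<lambda>m. chromatic_sf G m -
     schur_coeff (replicate n 1) (chromatic_sf G) / schur_coeff (replicate n 1) (chromatic_sf H)
       * chromatic_sf H m)"

text \<open>
  Vertices are natural numbers; every finite graph is isomorphic to such a graph, and isomorphic
  graphs have the same chromatic symmetric function.
\<close>

definition connected_graphs :: "nat \<Rightarrow> nat pair_pre_digraph set" where
  "connected_graphs n =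
     {G. pair_graph G \<and> Digraph_Component.connected (with_proj G) \<and> card (pverts G) = n}"

definition chromatic_equiv :: "nat \<Rightarrow> (nat pair_pre_digraph \<times> nat pair_pre_digraph) set" where
  "chromatic_equiv n =
     {(G, H). G \<in> connected_graphs n \<and> H \<in> connected_graphs n \<and> chromatic_sf G = chromatic_sf H}"

text \<open>
  \<open>A\<close> is below \<open>B\<close> when \<open>X_s n G H\<close> is Schur-positive for representatives \<open>G\<close> of \<open>B\<close> and \<open>H\<close> of
  \<open>A\<close>; since \<open>X_s\<close> only depends on the chromatic symmetric functions, the choice is immaterial.
\<close>

definition S_poset :: "nat \<Rightarrow> nat pair_pre_digraph set gorder" where
  "S_poset n =
     \<lparr>carrier = connected_graphs n // chromatic_equiv n,
      eq = (=),
      le = (\<lambda>A B. \<exists>G \<in> B. \<exists>H \<in> A. schur_positive (X_s n G H))\<rparr>"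

end

theory Submission
  imports Defs
begin

text \<open>
  Write \<open>c\<^sub>\<mu>(G)\<close> for the Schur coefficients of \<open>X\<^sub>G\<close>, divided by the coefficient of \<open>s\<close> at
  \<open>(1\<^sup>n)\<close>. The latter is the number of acyclic orientations of \<open>G\<close>, hence positive, so the order is the
  componentwise order of the vectors \<open>c(G)\<close>. Two graphs with the same \<open>c\<close> have proportional \<open>X\<close>, and the
  factor is \<open>1\<close> because the coefficient of \<open>x\<^sub>1 \<dots> x\<^sub>n\<close> is always \<open>n!\<close>.

  The complete graph and the star have no common lower bound. If \<open>G\<close> is below \<open>K\<^sub>n\<close>, then
  \<open>c\<^sub>\<mu>(G) \<le> 0\<close> for \<open>\<mu> \<noteq> (1\<^sup>n)\<close>. The coefficient of \<open>x\<^sup>\<mu>\<close> in \<open>X\<^sub>G\<close> is nonnegative, and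
  the Schur function of \<open>(1\<^sup>n)\<close> does not contribute to it, so \<open>c\<^sub>\<mu>(G) = 0\<close>. A star above \<open>G\<close> would
  therefore be Schur-positive. But it has a colouring of content \<open>(n - 1, 1)\<close> and none of content
  \<open>(n - 2, 2)\<close>, which is impossible for a Schur-positive function.
\<close>

section \<open>Contents and labellings\<close>

text \<open>\<open>schur_coeff\<close> is a definite description, so it carries no information until
  every symmetric series is known to have exactly one Schur expansion. Existence rests on the
  symmetry of Schur functions and on Kostka triangularity, uniqueness on triangularity alone; both
  facts are derived directly from tableaux. Tableaux and proper colourings are instances of one
  notion, \<open>labellings\<close>, and the common tool is the removal of all cells with the
  largest label. The resulting recursions are used twice: on tableaux they lead to symmetry, and on
  both sides they evaluate the alternating sum that extracts the coefficient at (1^n). For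
  colourings this sum obeys the recursion obtained by deleting sources of acyclic orientations.

  The bound n >= 4 comes from the star: the colour of its centre occurs exactly once, which
  contradicts content (n - 2, 2) only if n - 2 >= 2. For n = 3 the content (1, 2) does occur. The
  order axioms are proved as well, since a failure of one of them would already refute
  \<open>lattice\<close>.\<close>

definition content_mset :: "nat list \<Rightarrow> nat multiset" where
  "content_mset \<alpha> = (\<Sum>i<length \<alpha>. replicate_mset (\<alpha> ! i) (Suc i))"

lemma content_mset_Nil [simp]: "content_mset [] = {#}"
  by (simp add: content_mset_def)

text \<open>Inductions run from the end of the exponent list, because its last entry belongs to the
  largest label.\<close>

lemma content_mset_snoc:
  "content_mset (\<alpha> @ [a]) = content_mset \<alpha> + replicate_mset a (Suc (length \<alpha>))"
  by (simp add: content_mset_def nth_append)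

lemma content_mset_snoc_0 [simp]: "content_mset (\<alpha> @ [0]) = content_mset \<alpha>"
  by (simp add: content_mset_snoc)

lemma content_mset_append_zeros [simp]: "content_mset (\<alpha> @ replicate z 0) = content_mset \<alpha>"
  by (induction z) (simp_all add: replicate_append_same[symmetric] flip: append_assoc)

lemma size_content_mset [simp]: "size (content_mset \<alpha>) = sum_list \<alpha>"
  by (induction \<alpha> rule: rev_induct) (simp_all add: content_mset_snoc)

lemma count_content_mset:
  "count (content_mset \<alpha>) (Suc i) = (if i < length \<alpha> then \<alpha> ! i else 0)"
  by (induction \<alpha> rule: rev_induct) (auto simp: content_mset_snoc nth_append less_Suc_eq)

lemma set_content_mset: "set_mset (content_mset \<alpha>) \<subseteq> {1..length \<alpha>}"
  by (induction \<alpha> rule: rev_induct) (auto simp: content_mset_snoc split: if_splits)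

lemma zero_notin_content_mset [simp]: "0 \<notin># content_mset \<alpha>"
  using set_content_mset[of \<alpha>] by auto

lemma count_content_mset_0 [simp]: "count (content_mset \<alpha>) 0 = 0"
  by (simp add: not_in_iff[symmetric])

lemma obtain_content_mset:
  assumes "0 \<notin># m"
  obtains \<alpha> where "m = content_mset \<alpha>"
proof
  define N where "N = Max (insert 0 (set_mset m))"
  have N: "x \<le> N" if "x \<in># m" for x
    using that by (simp add: N_def)
  show "m = content_mset (map (\<lambda>i. count m (Suc i)) [0..<N])"
  proof (rule multiset_eqI)
    fix x
    show "count m x = count (content_mset (map (\<lambda>i. count m (Suc i)) [0..<N])) x"
    proof (cases x)
      case 0
      then show ?thesis using assms by (simp add: not_in_iff)
    next
      case (Suc i)
      then show ?thesis using N[of x] by (auto simp: count_content_mset not_in_iff[symmetric])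
    qed
  qed
qed

text \<open>Trailing zeros are the only ambiguity of an exponent list, and a partition has no zero
  part.\<close>

lemma content_mset_inj:
  assumes "content_mset \<nu> = content_mset \<mu>" "is_partition \<nu>" "is_partition \<mu>"
  shows "\<nu> = \<mu>"
proof -
  have le: "length \<alpha> \<le> length \<beta>" if "content_mset \<alpha> = content_mset \<beta>" "is_partition \<alpha>" for \<alpha> \<beta>
  proof (rule ccontr)
    assume "\<not> length \<alpha> \<le> length \<beta>"
    then have *: "length \<beta> < length \<alpha>" by simp
    then have "\<alpha> ! length \<beta> = 0"
      using count_content_mset[of \<alpha> "length \<beta>"] that(1) by (simp add: count_content_mset)
    with * that(2) show False
      by (metis is_partition_def nth_mem)
  qed
  have "length \<nu> = length \<mu>"
    using le[of \<nu> \<mu>] le[of \<mu> \<nu>] assms by simp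
  moreover have "\<nu> ! i = \<mu> ! i" if "i < length \<nu>" for i
    using count_content_mset[of \<nu> i] count_content_mset[of \<mu> i] assms(1) that calculation by simp
  ultimately show ?thesis by (simp add: nth_equalityI)
qed

text \<open>A common form for tableaux and proper colourings: \<open>C x y s t\<close> says whether
  the labels \<open>s\<close> and \<open>t\<close> may stand at \<open>x\<close> and
  \<open>y\<close>. One removal lemma then serves both.\<close>

definition labellings ::
    "('a \<Rightarrow> 'a \<Rightarrow> nat \<Rightarrow> nat \<Rightarrow> bool) \<Rightarrow> 'a set \<Rightarrow> nat multiset \<Rightarrow> ('a \<Rightarrow> nat) set" where
  "labellings C A m =
    {T \<in> A \<rightarrow>\<^sub>E {1..}. (\<forall>x\<in>A. \<forall>y\<in>A. C x y (T x) (T y)) \<and> monomial_of T A = m}"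

lemma monomial_of_restrict [simp]: "finite A \<Longrightarrow> monomial_of (restrict T A) A = monomial_of T A"
  unfolding monomial_of_def by (rule image_mset_cong) simp

lemma set_monomial_of [simp]: "finite A \<Longrightarrow> set_mset (monomial_of T A) = T ` A"
  by (simp add: monomial_of_def)

lemma size_monomial_of [simp]: "size (monomial_of T A) = card A"
  by (simp add: monomial_of_def)

lemma monomial_of_split:
  assumes "finite A" "B \<subseteq> A"
  shows "monomial_of T A = monomial_of T (A - B) + monomial_of T B"
proof -
  have "mset_set A = mset_set (A - B) + mset_set B"
    using assms mset_set_Union[of "A - B" B] by (simp add: Un_absorb2 Int_commute finite_subset)
  then show ?thesis by (simp add: monomial_of_def)
qed

lemma finite_labellings [simp]:
  assumes "finite A"
  shows "finite (labellings C A m)"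
proof (rule finite_subset)
  show "labellings C A m \<subseteq> A \<rightarrow>\<^sub>E set_mset m"
    using assms by (auto simp: labellings_def)
  show "finite (A \<rightarrow>\<^sub>E set_mset m)"
    using assms by (simp add: finite_PiE)
qed

lemma labellings_empty: "labellings C {} m = (if m = {#} then {\<lambda>_. undefined} else {})"
  by (auto simp: labellings_def monomial_of_def)

lemma labellings_eq_empty:
  assumes "finite A" "0 \<in># m \<or> size m \<noteq> card A"
  shows "labellings C A m = {}"
  using assms by (fastforce simp: labellings_def PiE_iff)

text \<open>The cells \<open>B\<close> that carry the largest label \<open>Suc (length \<alpha>)\<close> are split off.\<close>

lemma card_labellings_snoc:
  assumes fin: "finite A"
    and C1: "\<And>x y s k. s < k \<Longrightarrow> C x y s k"
    and C2: "\<And>x y s k. s < k \<Longrightarrow> C y x k s \<longleftrightarrow> D y x"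
    and C3: "\<And>x y k. C x y k k \<longleftrightarrow> E x y"
  shows "card (labellings C A (content_mset (\<alpha> @ [a]))) =
    (\<Sum>B | B \<subseteq> A \<and> card B = a \<and> (\<forall>x\<in>B. (\<forall>y\<in>B. E x y) \<and> (\<forall>y\<in>A - B. D x y)).
       card (labellings C (A - B) (content_mset \<alpha>)))"
proof -
  define k where "k = Suc (length \<alpha>)"
  \<comment> \<open>When all other labels are below \<open>k\<close>, the hypotheses on
    \<open>C\<close> reduce every constraint on the cells labelled \<open>k\<close> to label-free
    conditions: \<open>E\<close> among these cells and \<open>D\<close> towards the remaining
    ones.\<close>
  define R where "R B \<longleftrightarrow> B \<subseteq> A \<and> card B = a \<and> (\<forall>x\<in>B. (\<forall>y\<in>B. E x y) \<and> (\<forall>y\<in>A - B. D x y))" for B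
  have k_notin: "k \<notin># content_mset \<alpha>"
    using set_content_mset[of \<alpha>] by (auto simp: k_def)
  have lt_k: "x < k" if "x \<in># content_mset \<alpha>" for x
    using set_content_mset[of \<alpha>] that by (auto simp: k_def)
  define f where "f T = ({x\<in>A. T x = k}, restrict T (A - {x\<in>A. T x = k}))" for T :: "'a \<Rightarrow> nat"
  define g where "g p = (\<lambda>x. if x \<in> fst p then k else snd p x)" for p :: "'a set \<times> ('a \<Rightarrow> nat)"
  \<comment> \<open>\<open>content_mset \<alpha>\<close> only contains labels below
    \<open>k\<close>, so the multiplicity of \<open>k\<close> determines the number of cells
    labelled \<open>k\<close>.\<close>
  have mono: "card {x\<in>A. T x = k} = a \<and> monomial_of T (A - {x\<in>A. T x = k}) = content_mset \<alpha>
      \<longleftrightarrow> monomial_of T A = content_mset (\<alpha> @ [a])" for T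
  proof -
    let ?B = "{x\<in>A. T x = k}"
    have "monomial_of T ?B = image_mset (\<lambda>_. k) (mset_set ?B)"
      unfolding monomial_of_def by (rule image_mset_cong) (use fin in simp)
    then have eq: "monomial_of T A = monomial_of T (A - ?B) + replicate_mset (card ?B) k"
      using monomial_of_split[OF fin, of ?B T] by (simp add: image_mset_const_eq)
    have "k \<notin># monomial_of T (A - ?B)"
      using fin by auto
    then have "count (monomial_of T A) k = card ?B"
      by (simp add: eq not_in_iff)
    moreover have "count (content_mset (\<alpha> @ [a])) k = a"
      using k_notin by (simp add: content_mset_snoc k_def[symmetric] not_in_iff)
    ultimately have "card ?B = a" if "monomial_of T A = content_mset (\<alpha> @ [a])"
      using that by simp
    then show ?thesis
      by (auto simp: eq content_mset_snoc k_def[symmetric])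
  qed
  have "bij_betw f (labellings C A (content_mset (\<alpha> @ [a])))
          (SIGMA B:{B. R B}. labellings C (A - B) (content_mset \<alpha>))"
  proof (rule bij_betw_byWitness[where f' = g])
    show "\<forall>T\<in>labellings C A (content_mset (\<alpha> @ [a])). g (f T) = T"
      by (auto simp: f_def g_def labellings_def PiE_def extensional_def fun_eq_iff)
    show "\<forall>p\<in>(SIGMA B:{B. R B}. labellings C (A - B) (content_mset \<alpha>)). f (g p) = p"
    proof safe
      fix B T assume B: "R B" and T: "T \<in> labellings C (A - B) (content_mset \<alpha>)"
      have "T x < k" if "x \<in> A - B" for x
      proof -
        have "T x \<in># monomial_of T (A - B)" using fin that by auto
        then show ?thesis using T lt_k by (simp add: labellings_def)
      qed
      then have "{x\<in>A. g (B, T) x = k} = B"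
        using B by (auto simp: g_def R_def)
      then show "f (g (B, T)) = (B, T)"
        using T by (auto simp: f_def g_def labellings_def PiE_def extensional_def fun_eq_iff)
    qed
    show "f ` labellings C A (content_mset (\<alpha> @ [a]))
        \<subseteq> (SIGMA B:{B. R B}. labellings C (A - B) (content_mset \<alpha>))"
    proof (rule image_subsetI)
      fix T assume T: "T \<in> labellings C A (content_mset (\<alpha> @ [a]))"
      obtain B T' where eq: "f T = (B, T')" by fastforce
      have B: "B = {x\<in>A. T x = k}" and T': "T' = restrict T (A - B)"
        using eq by (auto simp: f_def)
      have m: "card B = a" "monomial_of T (A - B) = content_mset \<alpha>"
        using mono[of T] T by (auto simp: labellings_def B)
      have lt: "T x < k" if "x \<in> A - B" for x
        using lt_k[of "T x"] fin that unfolding m(2)[symmetric] by auto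
      have C: "C x y (T x) (T y)" if "x \<in> A" "y \<in> A" for x y
        using T that by (simp add: labellings_def)
      have "R B"
        unfolding R_def
      proof (intro conjI ballI)
        show "B \<subseteq> A" by (auto simp: B)
        show "card B = a" by fact
        show "E x y" if "x \<in> B" "y \<in> B" for x y
          using C[of x y] C3[of x y k] that by (auto simp: B)
        show "D x y" if "x \<in> B" "y \<in> A - B" for x y
          using C[of x y] C2[OF lt[OF that(2)], of x y] that by (auto simp: B)
      qed
      moreover have "T' \<in> labellings C (A - B) (content_mset \<alpha>)"
        using T m fin by (auto simp: labellings_def T')
      ultimately show "f T \<in> (SIGMA B:{B. R B}. labellings C (A - B) (content_mset \<alpha>))"
        by (simp add: eq)
    qed
    show "g ` (SIGMA B:{B. R B}. labellings C (A - B) (content_mset \<alpha>))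
        \<subseteq> labellings C A (content_mset (\<alpha> @ [a]))"
    proof (rule image_subsetI)
      fix p assume "p \<in> (SIGMA B:{B. R B}. labellings C (A - B) (content_mset \<alpha>))"
      then obtain B T where p: "p = (B, T)" and B: "R B"
        and T: "T \<in> labellings C (A - B) (content_mset \<alpha>)"
        by blast
      let ?T = "g (B, T)"
      have lt: "T x < k" if "x \<in> A - B" for x
      proof -
        have "T x \<in># monomial_of T (A - B)" using fin that by auto
        then show ?thesis using T lt_k by (simp add: labellings_def)
      qed
      then have B': "{x\<in>A. ?T x = k} = B"
        using B by (auto simp: g_def R_def)
      have "monomial_of ?T (A - B) = monomial_of T (A - B)"
        unfolding monomial_of_def by (rule image_mset_cong) (use fin in \<open>simp add: g_def\<close>)
      then have "monomial_of ?T A = content_mset (\<alpha> @ [a])"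
        using mono[of ?T] T B by (simp add: B' labellings_def R_def)
      moreover have "C x y (?T x) (?T y)" if "x \<in> A" "y \<in> A" for x y
        using that B T lt[of x] lt[of y] C1[of "T x" k x y] C2[of "T y" k x y] C3[of x y k]
        by (auto simp: g_def R_def labellings_def)
      moreover have "?T \<in> A \<rightarrow>\<^sub>E {1..}"
        using B T by (auto simp: g_def R_def labellings_def k_def PiE_iff extensional_def)
      ultimately show "g p \<in> labellings C A (content_mset (\<alpha> @ [a]))"
        by (simp add: labellings_def p)
    qed
  qed
  then have "card (labellings C A (content_mset (\<alpha> @ [a]))) =
      card (SIGMA B:{B. R B}. labellings C (A - B) (content_mset \<alpha>))"
    by (rule bij_betw_same_card)
  also have "\<dots> = (\<Sum>B | R B. card (labellings C (A - B) (content_mset \<alpha>)))"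
    using fin by (intro card_SigmaI) (auto simp: R_def intro: finite_subset[of _ "Pow A"])
  finally show ?thesis by (simp add: R_def)
qed

section \<open>Tableaux and horizontal strips\<close>

definition tableau_rel :: "nat \<times> nat \<Rightarrow> nat \<times> nat \<Rightarrow> nat \<Rightarrow> nat \<Rightarrow> bool" where
  "tableau_rel x y s t \<longleftrightarrow>
    (fst x = fst y \<and> snd x < snd y \<longrightarrow> s \<le> t) \<and> (snd x = snd y \<and> fst x < fst y \<longrightarrow> s < t)"

definition diagram :: "(nat \<Rightarrow> nat) \<Rightarrow> (nat \<times> nat) set" where
  "diagram f = {(i, j). j < f i}"

text \<open>Partitions as eventually zero functions: interlacing conditions then need no case
  distinction on the number of rows.\<close>

definition shape :: "(nat \<Rightarrow> nat) \<Rightarrow> bool" where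
  "shape f \<longleftrightarrow> antimono f \<and> (\<exists>N. \<forall>i\<ge>N. f i = 0)"

text \<open>The interlacing form of the condition that the skew shape \<open>f/g\<close> is a
  horizontal strip, that is, has at most one cell in each column.\<close>

definition strip :: "(nat \<Rightarrow> nat) \<Rightarrow> (nat \<Rightarrow> nat) \<Rightarrow> bool" where
  "strip f g \<longleftrightarrow> (\<forall>i. f (Suc i) \<le> g i \<and> g i \<le> f i)"

definition tableaux :: "(nat \<Rightarrow> nat) \<Rightarrow> nat list \<Rightarrow> nat" where
  "tableaux f \<alpha> = card (labellings tableau_rel (diagram f) (content_mset \<alpha>))"

lemma mem_diagram [simp]: "(i, j) \<in> diagram f \<longleftrightarrow> j < f i"
  by (simp add: diagram_def)

lemma diagram_inj: "diagram f = diagram g \<Longrightarrow> f = g"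
proof
  fix i assume "diagram f = diagram g"
  then have "j < f i \<longleftrightarrow> j < g i" for j
    by (metis mem_diagram)
  then show "f i = g i" by (meson linorder_neqE_nat less_irrefl)
qed

lemma diagram_Sigma: "(\<And>i. i \<ge> N \<Longrightarrow> f i = 0) \<Longrightarrow> diagram f = (SIGMA i:{..<N}. {..<f i})"
  by (fastforce simp: diagram_def not_less[symmetric])

lemma card_diagram: "(\<And>i. i \<ge> N \<Longrightarrow> f i = 0) \<Longrightarrow> card (diagram f) = (\<Sum>i<N. f i)"
  by (subst diagram_Sigma[of N f]) auto

lemma finite_diagram [simp]: "shape f \<Longrightarrow> finite (diagram f)"
  unfolding shape_def using diagram_Sigma[of _ f] by (metis finite_SigmaI finite_lessThan)

lemma shape_antimono: "shape f \<Longrightarrow> i \<le> j \<Longrightarrow> f j \<le> f i"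
  by (simp add: shape_def antimonoD)

lemma strip_diagram_subset: "strip f g \<Longrightarrow> diagram g \<subseteq> diagram f"
  unfolding diagram_def strip_def using order_less_le_trans by blast

lemma strip_shape:
  assumes "strip f g" "shape f"
  shows "shape g"
proof -
  have "antimono g"
    unfolding antimono_iff_le_Suc using assms(1) by (meson strip_def le_trans)
  moreover from assms(2) obtain N where "\<forall>i\<ge>N. f i = 0" by (auto simp: shape_def)
  then have "\<forall>i\<ge>N. g i = 0"
    using assms(1) by (metis strip_def le_zero_eq)
  ultimately show ?thesis by (auto simp: shape_def)
qed

lemma finite_strips [simp]:
  assumes "shape f"
  shows "finite {g. strip f g}"
proof (rule finite_imageD)
  show "finite (diagram ` {g. strip f g})"
    by (rule finite_subset[of _ "Pow (diagram f)"]) (use assms strip_diagram_subset in auto)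
  show "inj_on diagram {g. strip f g}"
    by (auto intro: inj_onI diagram_inj)
qed

lemma finite_down_closed_nat:
  assumes "finite S" "\<And>i j. j \<in> S \<Longrightarrow> i < j \<Longrightarrow> i \<in> S"
  shows "S = {..<card S :: nat}"
proof (cases "S = {}")
  case False
  have "S = {..Max S}"
    using assms Max_in[OF assms(1) False] by (auto simp: le_less dest: Max_ge[OF assms(1)])
  then show ?thesis
    by (metis card_atMost lessThan_Suc_atMost)
qed simp

text \<open>By \<open>D\<close> the complement of \<open>B\<close> is closed to the left, so its
  rows are initial segments. If row \<open>i + 1\<close> of \<open>f\<close> reached beyond
  \<open>g i\<close>, the cell below \<open>(i, g i)\<close> would violate \<open>E\<close> when it
  is in \<open>B\<close> and \<open>D\<close> when it is not.\<close>

lemma strip_diagram_diff: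
  assumes B: "B \<subseteq> diagram f"
    and E: "\<And>x y. x \<in> B \<Longrightarrow> y \<in> B \<Longrightarrow> \<not> (snd x = snd y \<and> fst x < fst y)"
    and D: "\<And>x y. x \<in> B \<Longrightarrow> y \<in> diagram f - B \<Longrightarrow>
      \<not> (fst x = fst y \<and> snd x < snd y) \<and> \<not> (snd x = snd y \<and> fst x < fst y)"
    and f: "shape f"
  shows "\<exists>g. strip f g \<and> diagram f - B = diagram g"
proof -
  define g where "g i = card {j. (i, j) \<in> diagram f - B}" for i
  have row: "{j. (i, j) \<in> diagram f - B} = {..<g i}" for i
    unfolding g_def
  proof (rule finite_down_closed_nat)
    show "finite {j. (i, j) \<in> diagram f - B}"
      by (rule finite_subset[of _ "{..<f i}"]) auto
    show "j \<in> {j. (i, j) \<in> diagram f - B}"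
      if "j' \<in> {j. (i, j) \<in> diagram f - B}" "j < j'" for j j'
      using that D[of "(i, j)" "(i, j')"] by auto
  qed
  then have mem: "(i, j) \<in> diagram f - B \<longleftrightarrow> j < g i" for i j
    by blast
  then have "diagram f - B = diagram g"
    by (auto simp: diagram_def)
  moreover have "strip f g"
    unfolding strip_def
  proof (intro allI conjI)
    fix i
    show "g i \<le> f i"
      using mem[of i "f i"] by (auto simp: not_less[symmetric])
    show "f (Suc i) \<le> g i"
    proof (rule ccontr)
      assume "\<not> f (Suc i) \<le> g i"
      then have *: "g i < f (Suc i)" by simp
      moreover have "f (Suc i) \<le> f i" using shape_antimono[OF f, of i "Suc i"] by simp
      ultimately have "(i, g i) \<in> B" using mem[of i "g i"] by auto
      with E[of "(i, g i)" "(Suc i, g i)"] D[of "(i, g i)" "(Suc i, g i)"] * show False by auto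
    qed
  qed
  ultimately show ?thesis by blast
qed

lemma tableaux_Nil: "shape f \<Longrightarrow> tableaux f [] = (if f = (\<lambda>_. 0) then 1 else 0)"
proof -
  assume f: "shape f"
  have "diagram (\<lambda>_. 0) = {}" by (simp add: diagram_def)
  moreover have "diagram f \<noteq> {}" if "f \<noteq> (\<lambda>_. 0)"
    using that calculation diagram_inj by metis
  ultimately show ?thesis
    using f by (auto simp: tableaux_def labellings_empty labellings_eq_empty)
qed

text \<open>The branching rule for Kostka numbers: the cells with the largest entry form a
  horizontal strip, and the others form a tableau of the inner shape.\<close>

lemma tableaux_snoc:
  assumes f: "shape f"
  shows "tableaux f (\<alpha> @ [a]) =
    (\<Sum>g | strip f g \<and> card (diagram f) = card (diagram g) + a. tableaux g \<alpha>)"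
proof -
  let ?E = "\<lambda>x y. \<not> (snd x = snd y \<and> fst x < (fst y :: nat))"
  let ?D = "\<lambda>x y. \<not> (fst x = fst y \<and> snd x < (snd y :: nat)) \<and> \<not> (snd x = snd y \<and> fst x < (fst y :: nat))"
  let ?S = "{B. B \<subseteq> diagram f \<and> card B = a \<and> (\<forall>x\<in>B. (\<forall>y\<in>B. ?E x y) \<and> (\<forall>y\<in>diagram f - B. ?D x y))}"
  let ?G = "{g. strip f g \<and> card (diagram f) = card (diagram g) + a}"
  have fin: "finite (diagram f)" using f by simp
  have "tableaux f (\<alpha> @ [a]) =
      (\<Sum>B\<in>?S. card (labellings tableau_rel (diagram f - B) (content_mset \<alpha>)))"
    unfolding tableaux_def
    by (rule card_labellings_snoc[OF fin]) (auto simp: tableau_rel_def)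
  also have "\<dots> = (\<Sum>g\<in>?G. tableaux g \<alpha>)"
  proof (rule sum.reindex_cong)
    show "inj_on (\<lambda>g. diagram f - diagram g) ?G"
    proof (rule inj_onI)
      fix g h assume "g \<in> ?G" "h \<in> ?G" "diagram f - diagram g = diagram f - diagram h"
      then have "diagram g = diagram h"
        using strip_diagram_subset[of f g] strip_diagram_subset[of f h] by blast
      then show "g = h" by (rule diagram_inj)
    qed
    show "?S = (\<lambda>g. diagram f - diagram g) ` ?G"
    proof (intro equalityI subsetI)
      fix B assume B: "B \<in> ?S"
      then have "\<exists>g. strip f g \<and> diagram f - B = diagram g"
        by (intro strip_diagram_diff f) auto
      then obtain g where g: "strip f g" "diagram f - B = diagram g"
        by blast
      have "card (diagram f) = card (diagram g) + a"
        using B fin g(2) card_Diff_subset[of B "diagram f"] card_mono[of "diagram f" B]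
        by (auto simp: finite_subset)
      moreover have "B = diagram f - diagram g" using B g(2) by blast
      ultimately show "B \<in> (\<lambda>g. diagram f - diagram g) ` ?G" using g(1) by blast
    next
      fix B assume "B \<in> (\<lambda>g. diagram f - diagram g) ` ?G"
      then obtain g where g: "strip f g" and c: "card (diagram f) = card (diagram g) + a"
        and B: "B = diagram f - diagram g" by blast
      have sg: "shape g" using strip_shape g f by blast
      have "card B = a"
        using strip_diagram_subset[OF g] c fin by (simp add: B card_Diff_subset finite_subset)
      moreover have "?E x y" if "x \<in> B" "y \<in> B" for x y
      proof (cases x; cases y)
        fix i j i' j' assume x: "x = (i, j)" and y: "y = (i', j')"
        show ?thesis
        proof
          assume *: "snd x = snd y \<and> fst x < fst y"
          \<comment> \<open>A lower strip cell in the same column would give j < f i' <= f (i + 1)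
            <= g i <= j.\<close>
          then have "f i' \<le> f (Suc i)" "j' = j" using x y shape_antimono[OF f, of "Suc i" i'] by auto
          moreover have "f (Suc i) \<le> g i" using g by (simp add: strip_def)
          ultimately show False using that x y by (auto simp: B)
        qed
      qed
      moreover have "?D x y" if "x \<in> B" "y \<in> diagram f - B" for x y
      proof (cases x; cases y)
        fix i j i' j' assume x: "x = (i, j)" and y: "y = (i', j')"
        then have *: "g i \<le> j" "j' < g i'" using that by (auto simp: B)
        then show ?thesis
          using shape_antimono[OF sg, of i i'] by (auto simp: x y)
      qed
      ultimately show "B \<in> ?S" by (auto simp: B)
    qed
    show "card (labellings tableau_rel (diagram f - (diagram f - diagram g)) (content_mset \<alpha>)) = tableaux g \<alpha>"
      if "g \<in> ?G" for g
      using that strip_diagram_subset[of f g] by (simp add: tableaux_def double_diff)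
  qed
  finally show ?thesis .
qed

section \<open>Symmetry of Schur functions\<close>

text \<open>
  The Bender--Knuth involution, read off Gelfand--Tsetlin patterns: between \<open>f\<close> and \<open>h\<close> the rows
  of the intermediate shape vary independently in intervals, and reflecting all of these intervals
  exchanges the sizes of the two strips.
\<close>

definition toggle :: "(nat \<Rightarrow> nat) \<Rightarrow> (nat \<Rightarrow> nat) \<Rightarrow> (nat \<Rightarrow> nat) \<Rightarrow> nat \<Rightarrow> nat" where
  "toggle f h g i =
    max (f (Suc i)) (h i) + (case i of 0 \<Rightarrow> f 0 | Suc k \<Rightarrow> min (f (Suc k)) (h k)) - g i"

text \<open>The bounds on \<open>g i\<close> mention only \<open>f\<close> and \<open>h\<close>,
  which makes the rows independent. The first row has no row of \<open>h\<close> above it, hence the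
  separate bound \<open>f 0\<close>.\<close>

lemma interlacing_iff:
  "strip f g \<and> strip g h \<longleftrightarrow>
    (\<forall>i. max (f (Suc i)) (h i) \<le> g i \<and> g i \<le> (case i of 0 \<Rightarrow> f 0 | Suc k \<Rightarrow> min (f (Suc k)) (h k)))"
  (is "?L \<longleftrightarrow> ?R")
proof
  assume ?L
  then show ?R by (auto simp: strip_def split: nat.split)
next
  assume R: ?R
  have "g (Suc i) \<le> h i" for i
    using R[rule_format, of "Suc i"] by simp
  moreover have "g i \<le> f i" for i
    using R[rule_format, of i] by (auto split: nat.splits)
  ultimately show ?L
    using R by (auto simp: strip_def)
qed

lemma strip_toggle:
  assumes "strip f g" "strip g h"
  shows "strip f (toggle f h g)" "strip (toggle f h g) h" "toggle f h (toggle f h g) = g"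
proof -
  have *: "max (f (Suc i)) (h i) \<le> g i \<and> g i \<le> (case i of 0 \<Rightarrow> f 0 | Suc k \<Rightarrow> min (f (Suc k)) (h k))" for i
    using assms interlacing_iff by blast
  have "max (f (Suc i)) (h i) \<le> toggle f h g i \<and>
      toggle f h g i \<le> (case i of 0 \<Rightarrow> f 0 | Suc k \<Rightarrow> min (f (Suc k)) (h k))" for i
    using *[of i] unfolding toggle_def by linarith
  then show "strip f (toggle f h g)" "strip (toggle f h g) h"
    using interlacing_iff by blast+
  have "toggle f h (toggle f h g) i = g i" for i
    using *[of i] unfolding toggle_def by linarith
  then show "toggle f h (toggle f h g) = g" by blast
qed

text \<open>In each row \<open>toggle f h g i + g i\<close> is the sum of the two interval ends.
  After summation the maximum and the minimum of \<open>f (Suc i)\<close> and \<open>h i\<close>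
  recombine to \<open>f (Suc i) + h i\<close>, and \<open>f 0\<close> completes the size of
  \<open>f\<close>.\<close>

lemma card_diagram_toggle:
  assumes f: "shape f" and fg: "strip f g" and gh: "strip g h"
  shows "card (diagram (toggle f h g)) + card (diagram g) = card (diagram f) + card (diagram h)"
proof -
  have g: "shape g" using strip_shape f fg by blast
  have h: "shape h" using strip_shape g gh by blast
  obtain N where N: "\<And>i. i \<ge> N \<Longrightarrow> f i = 0" using f by (auto simp: shape_def)
  have Ng: "g i = 0" if "i \<ge> N" for i using N[OF that] fg by (metis strip_def le_zero_eq)
  have Nh: "h i = 0" if "i \<ge> N" for i using Ng[OF that] gh by (metis strip_def le_zero_eq)
  have Nt: "toggle f h g i = 0" if "i \<ge> N" for i
    using N[OF that] strip_toggle(1)[OF fg gh] by (metis strip_def le_zero_eq)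
  let ?lo = "\<lambda>i. max (f (Suc i)) (h i)"
  let ?hi = "\<lambda>i. case i of 0 \<Rightarrow> f 0 | Suc k \<Rightarrow> min (f (Suc k)) (h k)"
  have "toggle f h g i + g i = ?lo i + ?hi i" for i
    using fg gh interlacing_iff[of f g h] by (auto simp: toggle_def intro!: le_add_diff_inverse2 trans_le_add2)
  then have "(\<Sum>i<Suc N. toggle f h g i) + (\<Sum>i<Suc N. g i) = (\<Sum>i<Suc N. ?lo i) + (\<Sum>i<Suc N. ?hi i)"
    by (simp only: sum.distrib[symmetric])
  also have "(\<Sum>i<Suc N. ?hi i) = f 0 + (\<Sum>i<N. min (f (Suc i)) (h i))"
    by (subst sum.lessThan_Suc_shift) simp
  also have "(\<Sum>i<Suc N. ?lo i) = (\<Sum>i<N. max (f (Suc i)) (h i))"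
    using N Nh by simp
  also have "(\<Sum>i<N. max (f (Suc i)) (h i)) + (f 0 + (\<Sum>i<N. min (f (Suc i)) (h i)))
      = f 0 + (\<Sum>i<N. max (f (Suc i)) (h i) + min (f (Suc i)) (h i))"
    by (simp add: sum.distrib)
  also have "\<dots> = f 0 + (\<Sum>i<N. f (Suc i) + h i)"
    by (intro arg_cong[where f = "\<lambda>x. f 0 + x"] sum.cong) auto
  also have "\<dots> = (\<Sum>i<Suc N. f i) + (\<Sum>i<N. h i)"
    by (subst sum.lessThan_Suc_shift) (simp add: sum.distrib)
  finally show ?thesis
    using N Ng Nh Nt by (simp add: card_diagram[of N])
qed

text \<open>Removing two labels leaves chains of two strips from \<open>f\<close> to
  \<open>h\<close>; \<open>toggle\<close> keeps \<open>h\<close> and exchanges the strip sizes, so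
  the summand \<open>tableaux h \<alpha>\<close> is unaffected.\<close>

lemma tableaux_snoc_swap:
  assumes f: "shape f"
  shows "tableaux f (\<alpha> @ [a, b]) = tableaux f (\<alpha> @ [b, a])"
proof -
  let ?S = "\<lambda>a b. (SIGMA g:{g. strip f g \<and> card (diagram f) = card (diagram g) + b}.
              {h. strip g h \<and> card (diagram g) = card (diagram h) + a})"
  have expand: "tableaux f (\<alpha> @ [a, b]) = (\<Sum>(g, h)\<in>?S a b. tableaux h \<alpha>)" for a b
  proof -
    have "tableaux f (\<alpha> @ [a, b]) = tableaux f ((\<alpha> @ [a]) @ [b])" by simp
    also have "\<dots> = (\<Sum>g | strip f g \<and> card (diagram f) = card (diagram g) + b.
        \<Sum>h | strip g h \<and> card (diagram g) = card (diagram h) + a. tableaux h \<alpha>)"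
      unfolding tableaux_snoc[OF f]
      by (rule sum.cong) (auto simp: tableaux_snoc dest: strip_shape[OF _ f])
    also have "\<dots> = (\<Sum>(g, h)\<in>?S a b. tableaux h \<alpha>)"
      by (rule sum.Sigma) (use f strip_shape[OF _ f] in \<open>auto intro: finite_subset[OF _ finite_strips]\<close>)
    finally show ?thesis .
  qed
  let ?t = "\<lambda>p. (toggle f (snd p) (fst p), snd p)"
  have mem: "?t p \<in> ?S b a" and inv: "?t (?t p) = p" if "p \<in> ?S a b" for p a b
    using that strip_toggle[of f "fst p" "snd p"] card_diagram_toggle[OF f, of "fst p" "snd p"] by auto
  show ?thesis
    unfolding expand
  proof (rule sum.reindex_bij_witness[where i = ?t and j = ?t])
    show "(case ?t p of (g, h) \<Rightarrow> tableaux h \<alpha>) = (case p of (g, h) \<Rightarrow> tableaux h \<alpha>)" for p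
      by (simp add: case_prod_beta)
  qed (fact mem inv)+
qed

text \<open>The labels after the exchanged pair are removed by the branching rule until the pair is
  last.\<close>

lemma tableaux_swap:
  assumes "shape f"
  shows "tableaux f (\<alpha> @ a # b # \<beta>) = tableaux f (\<alpha> @ b # a # \<beta>)"
  using assms
proof (induction \<beta> arbitrary: f rule: rev_induct)
  case Nil
  then show ?case by (simp add: tableaux_snoc_swap)
next
  case (snoc c \<beta>)
  have "tableaux f ((\<alpha> @ a # b # \<beta>) @ [c]) = tableaux f ((\<alpha> @ b # a # \<beta>) @ [c])"
    unfolding tableaux_snoc[OF snoc.prems]
    by (rule sum.cong) (use snoc.IH strip_shape[OF _ snoc.prems] in auto)
  then show ?case by simp
qed

section \<open>Triangularity\<close>

definition row_lengths :: "nat list \<Rightarrow> nat \<Rightarrow> nat" where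
  "row_lengths \<mu> i = (if i < length \<mu> then \<mu> ! i else 0)"

lemma young_diagram_eq: "young_diagram \<mu> = diagram (row_lengths \<mu>)"
  by (auto simp: young_diagram_def diagram_def row_lengths_def split: if_splits)

lemma shape_row_lengths [simp]:
  assumes "is_partition \<mu>"
  shows "shape (row_lengths \<mu>)"
proof -
  have "\<mu> ! j \<le> \<mu> ! i" if "i \<le> j" "j < length \<mu>" for i j
    using assms that by (cases "i = j") (auto simp: is_partition_def sorted_wrt_iff_nth_less)
  then have "antimono (row_lengths \<mu>)"
    by (auto simp: antimono_def row_lengths_def)
  moreover have "\<forall>i\<ge>length \<mu>. row_lengths \<mu> i = 0"
    by (simp add: row_lengths_def)
  ultimately show ?thesis
    unfolding shape_def by blast
qed

lemma finite_young_diagram [simp]: "finite (young_diagram \<mu>)"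
proof -
  have "young_diagram \<mu> = (SIGMA i:{..<length \<mu>}. {..<\<mu> ! i})"
    by (auto simp: young_diagram_def)
  then show ?thesis by simp
qed

lemma schur_eq: "schur \<mu> m = of_nat (card (labellings tableau_rel (young_diagram \<mu>) m))"
proof -
  have "{T \<in> ssyt \<mu>. monomial_of T (young_diagram \<mu>) = m} = labellings tableau_rel (young_diagram \<mu>) m"
    by (auto simp: ssyt_def labellings_def tableau_rel_def)
  then show ?thesis by (simp add: schur_def)
qed

lemma schur_content_mset: "schur \<mu> (content_mset \<alpha>) = of_nat (tableaux (row_lengths \<mu>) \<alpha>)"
  by (simp add: schur_eq tableaux_def young_diagram_eq)

text \<open>Row index plus one is the least entry that a tableau can have in a cell; this
  superstandard filling is the extremal case of the triangularity below.\<close>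

lemma monomial_of_row_index: "monomial_of (\<lambda>x. Suc (fst x)) (young_diagram \<mu>) = content_mset \<mu>"
proof (induction \<mu> rule: rev_induct)
  case Nil
  then show ?case by (simp add: monomial_of_def young_diagram_def)
next
  case (snoc a \<mu>)
  let ?R = "{length \<mu>} \<times> {..<a}"
  have "young_diagram (\<mu> @ [a]) - ?R = young_diagram \<mu>" "?R \<subseteq> young_diagram (\<mu> @ [a])"
    by (auto simp: young_diagram_def nth_append less_Suc_eq split: if_splits)
  then have "monomial_of (\<lambda>x. Suc (fst x)) (young_diagram (\<mu> @ [a])) =
      content_mset \<mu> + monomial_of (\<lambda>x. Suc (fst x)) ?R"
    using monomial_of_split[of "young_diagram (\<mu> @ [a])" ?R] snoc by simp
  also have "monomial_of (\<lambda>x. Suc (fst x)) ?R = image_mset (\<lambda>_. Suc (length \<mu>)) (mset_set ?R)"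
    unfolding monomial_of_def by (rule image_mset_cong) auto
  also have "\<dots> = replicate_mset a (Suc (length \<mu>))"
    by (simp add: image_mset_const_eq)
  finally show ?case by (simp add: content_mset_snoc)
qed

lemma card_young_diagram [simp]: "card (young_diagram \<mu>) = sum_list \<mu>"
  using arg_cong[OF monomial_of_row_index[of \<mu>], of size] by simp

text \<open>Columns increase strictly from an entry that is at least 1.\<close>

lemma tableau_entry_ge:
  assumes f: "shape f" and T: "T \<in> labellings tableau_rel (diagram f) m" and "j < f i"
  shows "Suc i \<le> T (i, j)"
  using \<open>j < f i\<close>
proof (induction i)
  case 0
  then have "T (0, j) \<in> {1..}" using T by (auto simp: labellings_def PiE_iff)
  then show ?case by simp
next
  case (Suc i)
  then have "j < f i" using shape_antimono[OF f, of i "Suc i"] by simp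
  moreover have "T (i, j) < T (Suc i, j)"
    using T Suc.prems calculation by (force simp: labellings_def tableau_rel_def)
  ultimately show ?case using Suc.IH by simp
qed

lemma sum_mset_monomial_of: "sum_mset (monomial_of T A) = (\<Sum>x\<in>A. T x)"
  by (simp add: monomial_of_def sum_unfold_sum_mset)

text \<open>
  Kostka triangularity with respect to \<open>sum_mset (content_mset \<mu>)\<close>, a linear statistic refining
  the dominance order: an entry in row \<open>i\<close> is at least \<open>Suc i\<close>.
\<close>

lemma tableau_content:
  assumes \<mu>: "is_partition \<mu>" and T: "T \<in> labellings tableau_rel (young_diagram \<mu>) m"
  shows "sum_mset (content_mset \<mu>) \<le> sum_mset m"
    and "sum_mset (content_mset \<mu>) = sum_mset m \<Longrightarrow> T = restrict (\<lambda>x. Suc (fst x)) (young_diagram \<mu>)"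
proof -
  have m: "sum_mset m = (\<Sum>x\<in>young_diagram \<mu>. T x)"
    using T by (auto simp: labellings_def sum_mset_monomial_of)
  have c: "sum_mset (content_mset \<mu>) = (\<Sum>x\<in>young_diagram \<mu>. Suc (fst x))"
    by (simp only: monomial_of_row_index[symmetric] sum_mset_monomial_of)
  have ge: "Suc (fst x) \<le> T x" if "x \<in> young_diagram \<mu>" for x
    using tableau_entry_ge[of "row_lengths \<mu>" T m "snd x" "fst x"] \<mu> T that
    by (cases x) (auto simp: young_diagram_eq)
  show "sum_mset (content_mset \<mu>) \<le> sum_mset m"
    unfolding m c by (rule sum_mono) (rule ge)
  assume eq: "sum_mset (content_mset \<mu>) = sum_mset m"
  have "T x = Suc (fst x)" if "x \<in> young_diagram \<mu>" for x
  proof (rule ccontr)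
    assume "T x \<noteq> Suc (fst x)"
    then have "Suc (fst x) < T x" using ge[OF that] by simp
    then have "(\<Sum>x\<in>young_diagram \<mu>. Suc (fst x)) < (\<Sum>x\<in>young_diagram \<mu>. T x)"
      using ge that by (intro sum_strict_mono_ex1) auto
    then show False using eq m c by simp
  qed
  then show "T = restrict (\<lambda>x. Suc (fst x)) (young_diagram \<mu>)"
    using T by (auto simp: labellings_def PiE_def extensional_def fun_eq_iff)
qed

text \<open>Triangularity in the form used for elimination: at a monomial whose statistic does not
  exceed that of the shape, only the diagonal coefficient can be nonzero.\<close>

lemma schur_eq_0_or_le:
  assumes "is_partition \<mu>" "schur \<mu> m \<noteq> 0"
  shows "sum_mset (content_mset \<mu>) \<le> sum_mset m"
    and "sum_mset m \<le> sum_mset (content_mset \<mu>) \<Longrightarrow> m = content_mset \<mu>"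
    and "0 \<notin># m" and "size m = sum_list \<mu>"
proof -
  obtain T where T: "T \<in> labellings tableau_rel (young_diagram \<mu>) m"
    using assms(2) by (metis schur_eq card.empty equals0I of_nat_0)
  show le: "sum_mset (content_mset \<mu>) \<le> sum_mset m"
    using tableau_content(1)[OF assms(1) T] .
  show "m = content_mset \<mu>" if "sum_mset m \<le> sum_mset (content_mset \<mu>)"
  proof -
    have "T = restrict (\<lambda>x. Suc (fst x)) (young_diagram \<mu>)"
      using tableau_content(2)[OF assms(1) T] le that by simp
    then show ?thesis
      using T by (simp add: labellings_def monomial_of_row_index)
  qed
  show "0 \<notin># m" "size m = sum_list \<mu>"
    using labellings_eq_empty[of "young_diagram \<mu>" m tableau_rel] T by auto
qed

lemma schur_self [simp]:
  assumes "is_partition \<mu>"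
  shows "schur \<mu> (content_mset \<mu>) = 1"
proof -
  let ?T = "restrict (\<lambda>x. Suc (fst x)) (young_diagram \<mu>)"
  have "?T \<in> labellings tableau_rel (young_diagram \<mu>) (content_mset \<mu>)"
    by (auto simp: labellings_def tableau_rel_def monomial_of_row_index)
  then have "labellings tableau_rel (young_diagram \<mu>) (content_mset \<mu>) = {?T}"
    using tableau_content(2)[OF assms _ refl] by blast
  then show ?thesis by (simp add: schur_eq)
qed

section \<open>Schur expansions of symmetric series\<close>

text \<open>Adjacent exchanges of exponents generate all permutations, and they are what the
  Bender--Knuth argument provides.\<close>

definition symmetric_series :: "nat \<Rightarrow> series \<Rightarrow> bool" where
  "symmetric_series n F \<longleftrightarrow>
    (\<forall>m. F m \<noteq> 0 \<longrightarrow> 0 \<notin># m \<and> size m = n) \<and>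
    (\<forall>\<alpha> a b \<beta>. F (content_mset (\<alpha> @ a # b # \<beta>)) = F (content_mset (\<alpha> @ b # a # \<beta>)))"

text \<open>The head of one list is moved to the front of the other by adjacent exchanges, and the
  tails are handled recursively. \<open>f\<close> is generalized since the recursion concerns
  \<open>f\<close> with a fixed head.\<close>

lemma invariant_under_permutations:
  assumes "\<And>\<alpha> a b \<beta>. f (\<alpha> @ a # b # \<beta>) = f (\<alpha> @ b # a # \<beta>)" "mset \<alpha> = mset \<beta>"
  shows "f \<alpha> = f \<beta>"
  using assms
proof (induction \<alpha> arbitrary: \<beta> f)
  case Nil
  then show ?case by simp
next
  case (Cons a \<alpha>)
  from Cons.prems(2) have "a \<in> set \<beta>"
    by (metis list.set_intros(1) set_mset_mset)
  then obtain ys zs where \<beta>: "\<beta> = ys @ a # zs"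
    by (auto simp: in_set_conv_decomp)
  have "f (ys @ a # zs) = f (a # ys @ zs)"
  proof (induction ys arbitrary: zs rule: rev_induct)
    case (snoc y ys)
    then show ?case using Cons.prems(1)[of ys y a zs] by simp
  qed simp
  also have "\<dots> = f (a # \<alpha>)"
  proof (rule sym, rule Cons.IH[of "\<lambda>l. f (a # l)"])
    show "f (a # \<gamma> @ b # c # \<delta>) = f (a # \<gamma> @ c # b # \<delta>)" for \<gamma> b c \<delta>
      using Cons.prems(1)[of "a # \<gamma>"] by simp
    show "mset \<alpha> = mset (ys @ zs)"
      using Cons.prems(2) by (simp add: \<beta>)
  qed
  finally show ?case by (simp add: \<beta>)
qed

definition compositions :: "nat \<Rightarrow> nat list set" where
  "compositions n = {\<alpha>. 0 \<notin> set \<alpha> \<and> sum_list \<alpha> = n}"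

definition partitions_of :: "nat \<Rightarrow> nat list set" where
  "partitions_of n = {\<mu>. is_partition \<mu> \<and> sum_list \<mu> = n}"

lemma finite_compositions [simp]: "finite (compositions n)"
proof (rule finite_subset)
  have "length \<alpha> \<le> sum_list \<alpha>" if "0 \<notin> set \<alpha>" for \<alpha> :: "nat list"
    using that by (induction \<alpha>) auto
  then show "compositions n \<subseteq> {\<alpha>. set \<alpha> \<subseteq> {..n} \<and> length \<alpha> \<le> n}"
    by (auto simp: compositions_def dest: member_le_sum_list)
  show "finite {\<alpha>. set \<alpha> \<subseteq> {..n} \<and> length \<alpha> \<le> n}"
    by (rule finite_lists_length_le) simp
qed

lemma finite_partitions_of [simp]: "finite (partitions_of n)"
  by (rule finite_subset[OF _ finite_compositions[of n]])
    (auto simp: partitions_of_def compositions_def is_partition_def)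

lemma symmetric_series_eqI:
  assumes F: "symmetric_series n F" and G: "symmetric_series n G"
    and eq: "\<And>\<mu>. \<mu> \<in> partitions_of n \<Longrightarrow> F (content_mset \<mu>) = G (content_mset \<mu>)"
  shows "F = G"
proof
  fix m
  show "F m = G m"
  proof (cases "0 \<notin># m \<and> size m = n")
    case False
    then show ?thesis using F G by (metis symmetric_series_def)
  next
    case True
    then obtain \<alpha> where \<alpha>: "m = content_mset \<alpha>"
      using obtain_content_mset by blast
    \<comment> \<open>Zero exponents are moved to the end of the list, where
      \<open>content_mset\<close> ignores them.\<close>
    define \<mu> where "\<mu> = rev (sort (filter (\<lambda>x. x \<noteq> 0) \<alpha>))"
    define z where "z = length (filter (\<lambda>x. x = 0) \<alpha>)"
    have "mset \<alpha> = mset (filter (\<lambda>x. x \<noteq> 0) \<alpha>) + replicate_mset z 0"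
      unfolding z_def by (induction \<alpha>) auto
    then have z: "mset \<alpha> = mset (\<mu> @ replicate z 0)"
      by (simp add: \<mu>_def)
    have "is_partition \<mu>"
      by (auto simp: is_partition_def \<mu>_def sorted_wrt_rev)
    moreover have "sum_list \<mu> = n"
      using arg_cong[OF z, of sum_mset] True \<alpha> by (simp add: sum_mset_sum_list sum_list_replicate)
    ultimately have "F (content_mset \<mu>) = G (content_mset \<mu>)"
      by (intro eq) (simp add: partitions_of_def)
    moreover have "H m = H (content_mset \<mu>)" if "symmetric_series n H" for H
      using invariant_under_permutations[of "\<lambda>\<alpha>. H (content_mset \<alpha>)", OF _ z] that
      by (simp add: symmetric_series_def \<alpha>)
    ultimately show ?thesis using F G by metis
  qed
qed

lemma symmetric_series_0: "symmetric_series n (\<lambda>_. 0)"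
  by (simp add: symmetric_series_def)

lemma symmetric_series_diff:
  "symmetric_series n F \<Longrightarrow> symmetric_series n G \<Longrightarrow> symmetric_series n (\<lambda>m. F m - r * G m)"
  unfolding symmetric_series_def
proof (intro conjI allI impI; elim conjE)
  fix m assume "F m - r * G m \<noteq> 0"
  then have "F m \<noteq> 0 \<or> G m \<noteq> 0" by auto
  moreover assume "\<forall>m. F m \<noteq> 0 \<longrightarrow> 0 \<notin># m \<and> size m = n" "\<forall>m. G m \<noteq> 0 \<longrightarrow> 0 \<notin># m \<and> size m = n"
  ultimately show "0 \<notin># m" "size m = n" by blast+
qed simp

lemma symmetric_series_schur:
  assumes "\<mu> \<in> partitions_of n"
  shows "symmetric_series n (schur \<mu>)"
  unfolding symmetric_series_def
proof (intro conjI allI impI)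
  have \<mu>: "is_partition \<mu>" "sum_list \<mu> = n"
    using assms by (auto simp: partitions_of_def)
  show "0 \<notin># m" "size m = n" if "schur \<mu> m \<noteq> 0" for m
    using schur_eq_0_or_le[OF \<mu>(1) that] \<mu>(2) by auto
  show "schur \<mu> (content_mset (\<alpha> @ a # b # \<beta>)) = schur \<mu> (content_mset (\<alpha> @ b # a # \<beta>))" for \<alpha> a b \<beta>
    using \<mu>(1) by (simp add: schur_content_mset tableaux_swap)
qed

text \<open>Triangular elimination. \<open>D\<close> holds the shapes still to be treated;
  \<open>F\<close> already vanishes at all others, and these have statistic at most that of any
  member of \<open>D\<close>. Each round treats a shape of least statistic in
  \<open>D\<close>.\<close>

lemma ex_schur_expansion_aux:
  assumes "finite D" "D \<subseteq> partitions_of n" "symmetric_series n F"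
    and "\<And>\<nu> \<mu>. \<nu> \<in> partitions_of n - D \<Longrightarrow> \<mu> \<in> D \<Longrightarrow>
      sum_mset (content_mset \<nu>) \<le> sum_mset (content_mset \<mu>)"
    and "\<And>\<nu>. \<nu> \<in> partitions_of n - D \<Longrightarrow> F (content_mset \<nu>) = 0"
  shows "\<exists>c. \<forall>m. F m = (\<Sum>\<mu>\<in>D. c \<mu> * schur \<mu> m)"
  using assms
proof (induction D arbitrary: F rule: finite_psubset_induct)
  case (psubset D)
  show ?case
  proof (cases "D = {}")
    case True
    then have "F = (\<lambda>_. 0)"
      using psubset.prems by (intro symmetric_series_eqI symmetric_series_0) auto
    then show ?thesis using True by simp
  next
    case False
    define stat where "stat \<mu> = sum_mset (content_mset \<mu>)" for \<mu> :: "nat list"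
    obtain \<mu> where \<mu>: "\<mu> \<in> D" and min: "\<And>\<nu>. \<nu> \<in> D \<Longrightarrow> stat \<mu> \<le> stat \<nu>"
      using ex_min_if_finite[of "stat ` D"] psubset.hyps False by (auto simp: not_less)
    have part: "is_partition \<mu>" using \<mu> psubset.prems(1) by (auto simp: partitions_of_def)
    \<comment> \<open>The coefficient of a Schur function at its own monomial is 1, so this clears
      \<open>F\<close> at \<open>\<mu>\<close>.\<close>
    define F' where "F' m = F m - F (content_mset \<mu>) * schur \<mu> m" for m
    have "\<exists>c. \<forall>m. F' m = (\<Sum>\<mu>\<in>D - {\<mu>}. c \<mu> * schur \<mu> m)"
    proof (rule psubset.IH)
      show "D - {\<mu>} \<subset> D" using \<mu> by blast
      show "D - {\<mu>} \<subseteq> partitions_of n" using psubset.prems by blast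
      show "symmetric_series n F'"
        unfolding F'_def using \<mu> psubset.prems
        by (intro symmetric_series_diff symmetric_series_schur) auto
      fix \<nu> assume \<nu>: "\<nu> \<in> partitions_of n - (D - {\<mu>})"
      show "sum_mset (content_mset \<nu>) \<le> sum_mset (content_mset \<kappa>)" if "\<kappa> \<in> D - {\<mu>}" for \<kappa>
        using \<nu> that psubset.prems(3)[of \<nu> \<kappa>] min[of \<kappa>] by (auto simp: stat_def)
      show "F' (content_mset \<nu>) = 0"
      proof (cases "\<nu> = \<mu>")
        case True
        then show ?thesis using part by (simp add: F'_def)
      next
        case False
        then have \<nu>': "\<nu> \<in> partitions_of n - D" using \<nu> by blast
        \<comment> \<open>A treated shape has statistic at most that of \<open>\<mu>\<close>, so by
          triangularity the subtraction does not disturb its zero.\<close>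
        have "schur \<mu> (content_mset \<nu>) = 0"
        proof (rule ccontr)
          assume "schur \<mu> (content_mset \<nu>) \<noteq> 0"
          then have "content_mset \<nu> = content_mset \<mu>"
            using schur_eq_0_or_le(2)[OF part] psubset.prems(3)[OF \<nu>' \<mu>] by blast
          then show False
            using content_mset_inj[of \<nu> \<mu>] False part \<nu>' by (simp add: partitions_of_def)
        qed
        then show ?thesis using psubset.prems(4)[OF \<nu>'] by (simp add: F'_def)
      qed
    qed
    then obtain c where c: "F' m = (\<Sum>\<nu>\<in>D - {\<mu>}. c \<nu> * schur \<nu> m)" for m
      by blast
    have "F m = (\<Sum>\<nu>\<in>D. (c(\<mu> := F (content_mset \<mu>))) \<nu> * schur \<nu> m)" for m
    proof -
      have "F m = F (content_mset \<mu>) * schur \<mu> m + (\<Sum>\<nu>\<in>D - {\<mu>}. c \<nu> * schur \<nu> m)"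
        using c[of m] by (simp add: F'_def)
      also have "(\<Sum>\<nu>\<in>D - {\<mu>}. c \<nu> * schur \<nu> m) =
          (\<Sum>\<nu>\<in>D - {\<mu>}. (c(\<mu> := F (content_mset \<mu>))) \<nu> * schur \<nu> m)"
        by (rule sum.cong) auto
      finally show ?thesis
        using sum.remove[OF psubset.hyps(1) \<mu>, of "\<lambda>\<nu>. (c(\<mu> := F (content_mset \<mu>))) \<nu> * schur \<nu> m"]
        by simp
    qed
    then show ?thesis by blast
  qed
qed

text \<open>Among the shapes where the coefficients differ, take one of least statistic: at its
  monomial the other differing shapes vanish, and the difference of the expansions is the difference
  of the two coefficients. Shapes of all sizes are compared together, as an expansion fixes no
  degree.\<close>

lemma schur_expansion_unique:
  assumes "schur_expansion F c" "schur_expansion F d"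
  shows "c = d"
proof (rule ccontr)
  assume "c \<noteq> d"
  define S where "S = {\<mu>. c \<mu> \<noteq> 0} \<union> {\<mu>. d \<mu> \<noteq> 0}"
  define stat where "stat \<mu> = sum_mset (content_mset \<mu>)" for \<mu> :: "nat list"
  have S: "finite S" "\<And>\<mu>. \<mu> \<in> S \<Longrightarrow> is_partition \<mu>"
    using assms by (auto simp: S_def schur_expansion_def)
  have extend: "F m = (\<Sum>\<mu>\<in>S. e \<mu> * schur \<mu> m)" if "schur_expansion F e" "{\<mu>. e \<mu> \<noteq> 0} \<subseteq> S" for e m
  proof -
    have "F m = (\<Sum>\<mu> | e \<mu> \<noteq> 0. e \<mu> * schur \<mu> m)"
      using that(1) by (simp add: schur_expansion_def)
    also have "\<dots> = (\<Sum>\<mu>\<in>S. e \<mu> * schur \<mu> m)"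
      by (rule sum.mono_neutral_left) (use that(2) S in auto)
    finally show ?thesis .
  qed
  have zero: "(\<Sum>\<mu>\<in>S. (c \<mu> - d \<mu>) * schur \<mu> m) = 0" for m
    using extend[OF assms(1), of m] extend[OF assms(2), of m]
    by (simp add: S_def left_diff_distrib sum_subtractf)
  define D where "D = {\<mu>. c \<mu> \<noteq> d \<mu>}"
  have D: "D \<subseteq> S" "D \<noteq> {}" using \<open>c \<noteq> d\<close> by (auto simp: D_def S_def)
  then have "finite D" using S(1) finite_subset by blast
  then obtain \<mu> where \<mu>: "\<mu> \<in> D" and min: "\<And>\<nu>. \<nu> \<in> D \<Longrightarrow> stat \<mu> \<le> stat \<nu>"
    using ex_min_if_finite[of "stat ` D"] D by (auto simp: not_less)
  have "schur \<nu> (content_mset \<mu>) = 0" if "\<nu> \<in> D" "\<nu> \<noteq> \<mu>" for \<nu>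
  proof (rule ccontr)
    assume "schur \<nu> (content_mset \<mu>) \<noteq> 0"
    then have "content_mset \<mu> = content_mset \<nu>"
      using schur_eq_0_or_le(2)[of \<nu>] min[OF that(1)] S(2) D that(1) by (auto simp: stat_def)
    then show False using content_mset_inj[of \<mu> \<nu>] S(2) D that \<mu> by auto
  qed
  then have "(\<Sum>\<nu>\<in>S. (c \<nu> - d \<nu>) * schur \<nu> (content_mset \<mu>)) = (\<Sum>\<nu>\<in>S. if \<nu> = \<mu> then c \<mu> - d \<mu> else 0)"
    by (intro sum.cong) (use S(2) \<mu> D in \<open>auto simp: D_def\<close>)
  also have "\<dots> = c \<mu> - d \<mu>" using S(1) \<mu> D by auto
  finally show False using zero \<mu> by (simp add: D_def)
qed

text \<open>This resolves the definite description: any expansion over the partitions of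
  \<open>n\<close> that is exhibited yields the coefficients.\<close>

lemma schur_coeff_unique:
  assumes F: "\<And>m. F m = (\<Sum>\<mu>\<in>partitions_of n. c \<mu> * schur \<mu> m)"
  shows "schur_coeff \<mu> F = (if \<mu> \<in> partitions_of n then c \<mu> else 0)"
proof -
  let ?c = "\<lambda>\<mu>. if \<mu> \<in> partitions_of n then c \<mu> else 0"
  have "schur_expansion F ?c"
    unfolding schur_expansion_def
  proof (intro conjI allI impI ext)
    show "finite {\<mu>. ?c \<mu> \<noteq> 0}"
      by (rule finite_subset[OF _ finite_partitions_of[of n]]) (auto split: if_splits)
    show "is_partition \<mu>" if "?c \<mu> \<noteq> 0" for \<mu>
      using that by (auto simp: partitions_of_def split: if_splits)
    show "F m = (\<Sum>\<mu> | ?c \<mu> \<noteq> 0. ?c \<mu> * schur \<mu> m)" for m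
      unfolding F by (rule sum.mono_neutral_cong_right) (auto split: if_splits)
  qed
  then have "(THE c. schur_expansion F c) = ?c"
    using schur_expansion_unique by blast
  then show ?thesis by (simp add: schur_coeff_def)
qed

lemma schur_coeff_expansion:
  assumes "symmetric_series n F"
  shows "F m = (\<Sum>\<mu>\<in>partitions_of n. schur_coeff \<mu> F * schur \<mu> m)"
proof -
  obtain c where c: "F m = (\<Sum>\<mu>\<in>partitions_of n. c \<mu> * schur \<mu> m)" for m
    using ex_schur_expansion_aux[of "partitions_of n" n F] assms by auto
  then have "schur_coeff \<mu> F = (if \<mu> \<in> partitions_of n then c \<mu> else 0)" for \<mu>
    by (rule schur_coeff_unique)
  then show ?thesis using c by simp
qed

lemma schur_coeff_eq_0:
  assumes "symmetric_series n F" "\<mu> \<notin> partitions_of n"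
  shows "schur_coeff \<mu> F = 0"
  using schur_coeff_unique[OF schur_coeff_expansion[OF assms(1)], of \<mu>] assms(2) by simp

lemma schur_coeff_diff:
  assumes F: "symmetric_series n F" and G: "symmetric_series n G"
  shows "schur_coeff \<mu> (\<lambda>m. F m - r * G m) = schur_coeff \<mu> F - r * schur_coeff \<mu> G"
proof -
  have "F m - r * G m = (\<Sum>\<mu>\<in>partitions_of n. (schur_coeff \<mu> F - r * schur_coeff \<mu> G) * schur \<mu> m)" for m
    unfolding schur_coeff_expansion[OF F, of m] schur_coeff_expansion[OF G, of m]
    by (simp add: sum_subtractf sum_distrib_left left_diff_distrib mult.assoc)
  from schur_coeff_unique[OF this, of \<mu>] show ?thesis
    by (simp add: schur_coeff_eq_0[OF F] schur_coeff_eq_0[OF G])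
qed

section \<open>The coefficient of the one-column Schur function\<close>

text \<open>
  The scalar product with \<open>e\<^sub>n = \<Sum>\<alpha>. (-1)\<^bsup>n - length \<alpha>\<^esup> h\<^sub>\<alpha>\<close>, the sum being over the compositions of \<open>n\<close>.
\<close>

definition alternating_sum :: "nat \<Rightarrow> (nat list \<Rightarrow> rat) \<Rightarrow> rat" where
  "alternating_sum n F = (\<Sum>\<alpha>\<in>compositions n. (-1) ^ (n + length \<alpha>) * F \<alpha>)"

lemma compositions_0 [simp]: "compositions 0 = {[]}"
proof -
  have "\<alpha> = []" if "0 \<notin> set \<alpha>" "sum_list \<alpha> = 0" for \<alpha> :: "nat list"
    using that by (cases \<alpha>) auto
  then show ?thesis by (auto simp: compositions_def)
qed

lemma sum_compositions_snoc:
  fixes h :: "nat list \<Rightarrow> rat"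
  assumes "n > 0"
  shows "(\<Sum>\<alpha>\<in>compositions n. h \<alpha>) = (\<Sum>a\<in>{1..n}. \<Sum>\<alpha>\<in>compositions (n - a). h (\<alpha> @ [a]))"
proof -
  have "(\<Sum>\<alpha>\<in>compositions n. h \<alpha>) = (\<Sum>p\<in>(SIGMA a:{1..n}. compositions (n - a)). h (snd p @ [fst p]))"
  proof (rule sum.reindex_bij_witness[where i = "\<lambda>p. snd p @ [fst p]" and j = "\<lambda>\<alpha>. (last \<alpha>, butlast \<alpha>)"])
    fix \<alpha> assume \<alpha>: "\<alpha> \<in> compositions n"
    then have "\<alpha> \<noteq> []" using assms by (auto simp: compositions_def)
    then obtain \<beta> a where "\<alpha> = \<beta> @ [a]" by (metis rev_exhaust)
    then show "snd (last \<alpha>, butlast \<alpha>) @ [fst (last \<alpha>, butlast \<alpha>)] = \<alpha>"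
      "(last \<alpha>, butlast \<alpha>) \<in> (SIGMA a:{1..n}. compositions (n - a))"
      "h (snd (last \<alpha>, butlast \<alpha>) @ [fst (last \<alpha>, butlast \<alpha>)]) = h \<alpha>"
      using \<alpha> by (auto simp: compositions_def)
  qed (auto simp: compositions_def)
  then show ?thesis
    by (simp add: sum.Sigma case_prod_beta)
qed

text \<open>Compositions are split by their last part, and \<open>rec\<close> removes the
  corresponding label. The objects \<open>x\<close> and \<open>y\<close> are left abstract because
  they are shapes for tableaux and vertex sets for colourings.\<close>

lemma alternating_sum_recursion:
  fixes N :: "'b \<Rightarrow> nat list \<Rightarrow> nat"
  assumes fin: "finite D" and pos: "sz x > 0"
    and rec: "\<And>\<alpha> a. N x (\<alpha> @ [a]) = (\<Sum>y | y \<in> D \<and> sz x = sz y + a. N y \<alpha>)"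
  shows "alternating_sum (sz x) (\<lambda>\<alpha>. of_nat (N x \<alpha>)) =
    (\<Sum>y | y \<in> D \<and> sz y < sz x.
      (-1) ^ (sz x + sz y + 1) * alternating_sum (sz y) (\<lambda>\<alpha>. of_nat (N y \<alpha>)))"
proof -
  let ?t = "\<lambda>y. (-1) ^ (sz x + sz y + 1) * alternating_sum (sz y) (\<lambda>\<alpha>. of_nat (N y \<alpha>))"
  let ?S = "{y. y \<in> D \<and> sz y < sz x}"
  have "(\<Sum>\<alpha>\<in>compositions (sz x - a). (-1) ^ (sz x + length (\<alpha> @ [a])) * of_nat (N x (\<alpha> @ [a])))
      = (\<Sum>y | y \<in> ?S \<and> sz x - sz y = a. ?t y)" if a: "a \<in> {1..sz x}" for a
  proof -
    have eq: "{y. y \<in> ?S \<and> sz x - sz y = a} = {y. y \<in> D \<and> sz x = sz y + a}"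
      using a by auto
    have "(\<Sum>\<alpha>\<in>compositions (sz x - a). (-1) ^ (sz x + length (\<alpha> @ [a])) * rat_of_nat (N x (\<alpha> @ [a])))
        = (\<Sum>y | y \<in> D \<and> sz x = sz y + a.
            \<Sum>\<alpha>\<in>compositions (sz x - a). (-1) ^ (sz x + length \<alpha> + 1) * of_nat (N y \<alpha>))"
      by (subst sum.swap) (simp add: rec sum_distrib_left sum_negf)
    also have "\<dots> = (\<Sum>y | y \<in> D \<and> sz x = sz y + a. ?t y)"
    proof (rule sum.cong[OF refl])
      fix y assume "y \<in> {y. y \<in> D \<and> sz x = sz y + a}"
      then have "sz x - a = sz y" by simp
      \<comment> \<open>The two exponents differ by \<open>2 * sz y\<close>.\<close>
      moreover have "(-1) ^ (sz x + length \<alpha> + 1) * rat_of_nat (N y \<alpha>) =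
          (-1) ^ (sz x + sz y + 1) * ((-1) ^ (sz y + length \<alpha>) * of_nat (N y \<alpha>))" for \<alpha>
        by (simp add: power_add mult.assoc[symmetric] flip: power_mult_distrib)
      ultimately show "(\<Sum>\<alpha>\<in>compositions (sz x - a). (-1) ^ (sz x + length \<alpha> + 1) * rat_of_nat (N y \<alpha>)) = ?t y"
        by (simp only: alternating_sum_def sum_distrib_left)
    qed
    finally show ?thesis by (simp only: eq)
  qed
  then have "alternating_sum (sz x) (\<lambda>\<alpha>. of_nat (N x \<alpha>)) =
      (\<Sum>a\<in>{1..sz x}. \<Sum>y | y \<in> ?S \<and> sz x - sz y = a. ?t y)"
    unfolding alternating_sum_def[of "sz x"] sum_compositions_snoc[OF pos] by (rule sum.cong[OF refl])
  \<comment> \<open>Each smaller object occurs for exactly one last part, namely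
    \<open>sz x - sz y\<close>.\<close>
  also have "\<dots> = (\<Sum>y\<in>?S. ?t y)"
    using fin by (intro sum.group) auto
  finally show ?thesis .
qed

definition column :: "nat \<Rightarrow> nat \<Rightarrow> nat" where
  "column r i = (if i < r then 1 else 0)"

lemma card_diagram_column [simp]: "card (diagram (column r)) = r"
  by (subst card_diagram[of r]) (auto simp: column_def)

text \<open>By induction only inner shapes that are columns contribute, and interlacing leaves those
  with \<open>r\<close> or \<open>r - 1\<close> cells, where \<open>r\<close> is the number of rows
  of \<open>f\<close>. If \<open>f\<close> is a nonempty column, only the shorter one is smaller
  than \<open>f\<close>, with sign +1. If \<open>f\<close> is a hook with a longer first row, both
  occur and cancel. If the second row has two cells, neither interlaces.\<close>

lemma alternating_sum_tableaux:
  assumes "shape f"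
  shows "alternating_sum (card (diagram f)) (\<lambda>\<alpha>. of_nat (tableaux f \<alpha>)) = (if f 0 \<le> 1 then 1 else 0)"
  using assms
proof (induction "card (diagram f)" arbitrary: f rule: less_induct)
  case less
  show ?case
  proof (cases "f 0 = 0")
    case True
    then have "f i = 0" for i
      using shape_antimono[OF less.prems, of 0 i] by simp
    then have "f = (\<lambda>_. 0)" by blast
    moreover from this have "card (diagram f) = 0" by (simp add: diagram_def)
    ultimately show ?thesis
      using less.prems by (simp add: alternating_sum_def tableaux_Nil)
  next
    case False
    then have pos: "card (diagram f) > 0"
      using less.prems mem_diagram[of 0 0 f] by (auto simp: card_gt_0_iff simp del: mem_diagram)
    \<comment> \<open>The number of nonempty rows of \<open>f\<close>; below, \<open>q\<close> is
      one less.\<close>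
    define r where "r = (LEAST i. f i = 0)"
    have fr: "f r = 0"
      unfolding r_def using less.prems by (auto simp: shape_def intro: LeastI)
    have r: "f i \<noteq> 0 \<longleftrightarrow> i < r" for i
      using not_less_Least[of i "\<lambda>i. f i = 0"] shape_antimono[OF less.prems, of r i] fr
      by (cases "i < r") (auto simp: r_def)
    have "r > 0" using r[of 0] False by simp
    then obtain q where q: "r = Suc q" by (cases r) auto
    let ?S = "{g. strip f g \<and> card (diagram g) < card (diagram f)}"
    let ?sgn = "\<lambda>g. (-1) ^ (card (diagram f) + card (diagram g) + 1) :: rat"
    have "alternating_sum (card (diagram f)) (\<lambda>\<alpha>. of_nat (tableaux f \<alpha>)) =
        (\<Sum>g\<in>?S. ?sgn g * alternating_sum (card (diagram g)) (\<lambda>\<alpha>. of_nat (tableaux g \<alpha>)))"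
      using alternating_sum_recursion[where N = tableaux and D = "{g. strip f g}" and x = f and sz = "\<lambda>f. card (diagram f)"]
        less.prems pos tableaux_snoc[OF less.prems] by simp
    also have "\<dots> = (\<Sum>g\<in>?S. ?sgn g * (if g 0 \<le> 1 then 1 else 0))"
    proof (rule sum.cong[OF refl])
      fix g assume "g \<in> ?S"
      then show "?sgn g * alternating_sum (card (diagram g)) (\<lambda>\<alpha>. of_nat (tableaux g \<alpha>)) =
          ?sgn g * (if g 0 \<le> 1 then 1 else 0)"
        using less.hyps[of g] strip_shape[of f g] less.prems by simp
    qed
    also have "\<dots> = (\<Sum>g | g \<in> ?S \<and> g 0 \<le> 1. ?sgn g)"
      using finite_strips[OF less.prems] by (subst sum.inter_filter) (auto intro: sum.cong)
    also have "\<dots> = (if f 0 \<le> 1 then 1 else 0)"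
    proof -
      \<comment> \<open>For \<open>i < q\<close> interlacing gives \<open>g i\<close> at least
        \<open>f (Suc i)\<close>, which is positive, and \<open>g\<close> vanishes from row
        \<open>r\<close> on; only row \<open>q\<close> is free.\<close>
      have cols: "g = column q \<or> g = column r" if g: "strip f g" "g 0 \<le> 1" for g
      proof -
        have sg: "shape g" using strip_shape[OF g(1)] less.prems by blast
        have le1: "g i \<le> 1" for i
          using shape_antimono[OF sg, of 0 i] g(2) by simp
        have "g i = 1" if "i < q" for i
          using g(1) r[of "Suc i"] that le1[of i] unfolding q strip_def
          by (metis Suc_less_eq le_antisym le_zero_eq less_one not_le)
        moreover have "g i = 0" if "\<not> i < r" for i
          using g(1) r[of i] that unfolding strip_def by (metis le_zero_eq)
        moreover have "g q = 0 \<or> g q = 1" using le1[of q] by auto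
        ultimately have "(\<forall>i. g i = column q i) \<or> (\<forall>i. g i = column r i)"
          unfolding column_def q by (metis less_antisym less_Suc_eq)
        then show ?thesis by blast
      qed
      have strips: "strip f (column s)" if "f 1 \<le> 1" "s = q \<or> s = r" for s
        unfolding strip_def
      proof (intro allI)
        fix i
        have "f (Suc i) \<le> 1" using shape_antimono[OF less.prems, of 1 "Suc i"] that(1) by simp
        moreover have "f (Suc i) = 0" if "\<not> i < q" using r[of "Suc i"] that by (simp add: q)
        moreover have "1 \<le> f i" if "i < r" using r[of i] that by linarith
        ultimately show "f (Suc i) \<le> column s i \<and> column s i \<le> f i"
          using that(2) q unfolding column_def by (cases "i < q"; cases "i < r"; cases "i < s") auto
      qed
      have le1: "column s 0 \<le> 1" for s by (simp add: column_def)
      show ?thesis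
      proof (cases "f 0 \<le> 1")
        case True
        have f: "f = column r"
        proof
          fix i
          have "f i \<le> 1" using shape_antimono[OF less.prems, of 0 i] True by simp
          then show "f i = column r i" using r[of i] unfolding column_def by presburger
        qed
        have card_f: "card (diagram f) = r" unfolding f by (rule card_diagram_column)
        have "strip f (column q)"
          using strips[of q] shape_antimono[OF less.prems, of 0 1] True by simp
        have "g \<in> ?S \<and> g 0 \<le> 1 \<longleftrightarrow> g = column q" for g
        proof
          assume g: "g \<in> ?S \<and> g 0 \<le> 1"
          then have "g \<noteq> column r" by (auto simp: card_f)
          then show "g = column q" using cols[of g] g by blast
        next
          assume "g = column q"
          then show "g \<in> ?S \<and> g 0 \<le> 1"
            using \<open>strip f (column q)\<close> le1[of q] by (simp add: card_f q)
        qed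
        then have "{g. g \<in> ?S \<and> g 0 \<le> 1} = {column q}" by blast
        then show ?thesis using True by (simp only: card_f sum.insert) (simp add: q)
      next
        case False
        show ?thesis
        proof (cases "f 1 \<le> 1")
          case True
          have "column r \<noteq> f"
            using False le1 by metis
          then have "diagram (column r) \<subset> diagram f"
            using strip_diagram_subset[OF strips[OF True, of r]] diagram_inj by blast
          then have "r < card (diagram f)"
            using psubset_card_mono[of "diagram f" "diagram (column r)"] less.prems by simp
          then have "column q \<in> ?S \<and> column q 0 \<le> 1" "column r \<in> ?S \<and> column r 0 \<le> 1"
            using strips[OF True, of q] strips[OF True, of r] le1 by (simp_all add: q)
          then have "{g. g \<in> ?S \<and> g 0 \<le> 1} = {column q, column r}"
            using cols by blast
          moreover have "column q \<noteq> column r"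
            using card_diagram_column[of q] card_diagram_column[of r] q by (metis n_not_Suc_n)
          ultimately show ?thesis using False by (simp add: q)
        next
          case f1: False
          have "\<not> (strip f g \<and> g 0 \<le> 1)" for g
          proof
            assume "strip f g \<and> g 0 \<le> 1"
            then have "f (Suc 0) \<le> g 0" "g 0 \<le> 1" by (auto simp: strip_def)
            then show False using f1 by simp
          qed
          then have "{g. g \<in> ?S \<and> g 0 \<le> 1} = {}" by blast
          then show ?thesis using False by (simp only: sum.empty if_False)
        qed
      qed
    qed
    finally show ?thesis .
  qed
qed

lemma replicate_1_partition: "replicate n 1 \<in> partitions_of n"
  by (auto simp: partitions_of_def is_partition_def sum_list_replicate sorted_wrt_iff_nth_less)

lemma partition_eq_replicate_1:
  assumes "\<mu> \<in> partitions_of n" "\<And>x. count (content_mset \<mu>) x \<le> 1"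
  shows "\<mu> = replicate n 1"
proof -
  have "\<forall>x\<in>set \<mu>. x = 1"
  proof
    fix x assume "x \<in> set \<mu>"
    then obtain i where "i < length \<mu>" "x = \<mu> ! i" by (auto simp: in_set_conv_nth)
    then have "x \<le> 1" using assms(2)[of "Suc i"] by (simp add: count_content_mset)
    moreover have "0 \<notin> set \<mu>"
      using assms(1) by (simp add: partitions_of_def is_partition_def)
    then have "x \<noteq> 0" using \<open>x \<in> set \<mu>\<close> by metis
    ultimately show "x = 1" by simp
  qed
  then obtain k where "\<mu> = replicate k 1" by (metis replicate_length_same)
  then show ?thesis using assms(1) by (simp add: partitions_of_def sum_list_replicate)
qed

text \<open>By linearity the alternating sum acts on the Schur expansion, and it annihilates every
  Schur function of degree \<open>n\<close> except the one-column one, on which it is 1.\<close>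

lemma schur_coeff_column:
  assumes F: "symmetric_series n F"
  shows "schur_coeff (replicate n 1) F = alternating_sum n (\<lambda>\<alpha>. F (content_mset \<alpha>))"
proof -
  have alt: "alternating_sum n (\<lambda>\<alpha>. schur \<mu> (content_mset \<alpha>)) = (if \<mu> = replicate n 1 then 1 else 0)"
    if "\<mu> \<in> partitions_of n" for \<mu>
  proof -
    have \<mu>: "is_partition \<mu>" "sum_list \<mu> = n" using that by (auto simp: partitions_of_def)
    have "card (diagram (row_lengths \<mu>)) = n" using \<mu> by (simp flip: young_diagram_eq)
    then have "alternating_sum n (\<lambda>\<alpha>. schur \<mu> (content_mset \<alpha>)) = (if row_lengths \<mu> 0 \<le> 1 then 1 else 0)"
      using alternating_sum_tableaux[of "row_lengths \<mu>"] \<mu> by (simp add: schur_content_mset)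
    moreover have "row_lengths \<mu> 0 \<le> 1 \<longleftrightarrow> \<mu> = replicate n 1"
    proof
      assume le: "row_lengths \<mu> 0 \<le> 1"
      have "count (content_mset \<mu>) x \<le> 1" for x
      proof (cases x)
        case (Suc i)
        then show ?thesis
          using shape_antimono[OF shape_row_lengths[OF \<mu>(1)], of 0 i] le
          by (simp add: count_content_mset row_lengths_def split: if_splits)
      qed simp
      then show "\<mu> = replicate n 1" using partition_eq_replicate_1[OF that] by blast
    qed (simp add: row_lengths_def)
    ultimately show ?thesis by simp
  qed
  have "alternating_sum n (\<lambda>\<alpha>. F (content_mset \<alpha>)) =
      (\<Sum>\<mu>\<in>partitions_of n. schur_coeff \<mu> F * alternating_sum n (\<lambda>\<alpha>. schur \<mu> (content_mset \<alpha>)))"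
    unfolding alternating_sum_def schur_coeff_expansion[OF F, of "content_mset _"] sum_distrib_left
    by (subst sum.swap) (simp add: mult.left_commute)
  also have "\<dots> = (\<Sum>\<mu>\<in>partitions_of n. if \<mu> = replicate n 1 then schur_coeff \<mu> F else 0)"
    by (rule sum.cong) (auto simp: alt)
  also have "\<dots> = schur_coeff (replicate n 1) F"
    using replicate_1_partition[of n] by (simp del: One_nat_def)
  finally show ?thesis by simp
qed

section \<open>Colourings and acyclic orientations\<close>

definition colour_rel :: "('a \<times> 'a) set \<Rightarrow> 'a \<Rightarrow> 'a \<Rightarrow> nat \<Rightarrow> nat \<Rightarrow> bool" where
  "colour_rel E x y s t \<longleftrightarrow> ((x, y) \<in> E \<longrightarrow> s \<noteq> t)"

definition colourings :: "('a \<times> 'a) set \<Rightarrow> 'a set \<Rightarrow> nat list \<Rightarrow> nat" where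
  "colourings E V \<alpha> = card (labellings (colour_rel E) V (content_mset \<alpha>))"

text \<open>Indexed by what remains after the removal of a colour class, since the remaining vertex
  set is the smaller object in the recursion.\<close>

definition stable_complements :: "('a \<times> 'a) set \<Rightarrow> 'a set \<Rightarrow> 'a set set" where
  "stable_complements E V = {W. W \<subseteq> V \<and> (\<forall>x\<in>V - W. \<forall>y\<in>V - W. (x, y) \<notin> E)}"

lemma colourings_snoc:
  assumes V: "finite V"
  shows "colourings E V (\<alpha> @ [a]) =
    (\<Sum>W | W \<in> stable_complements E V \<and> card V = card W + a. colourings E W \<alpha>)"
proof -
  let ?S = "{B. B \<subseteq> V \<and> card B = a \<and> (\<forall>x\<in>B. (\<forall>y\<in>B. (x, y) \<notin> E) \<and> (\<forall>y\<in>V - B. True))}"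
  have "colourings E V (\<alpha> @ [a]) = (\<Sum>B\<in>?S. card (labellings (colour_rel E) (V - B) (content_mset \<alpha>)))"
    unfolding colourings_def by (rule card_labellings_snoc[OF V]) (auto simp: colour_rel_def)
  also have "\<dots> = (\<Sum>W | W \<in> stable_complements E V \<and> card V = card W + a. colourings E W \<alpha>)"
  proof (rule sum.reindex_bij_witness[where i = "\<lambda>W. V - W" and j = "\<lambda>B. V - B"])
    fix B assume B: "B \<in> ?S"
    then show "V - (V - B) = B" by blast
    have "card (V - B) + a = card V"
      using B V by (auto simp: card_Diff_subset finite_subset card_mono)
    then show "V - B \<in> {W. W \<in> stable_complements E V \<and> card V = card W + a}"
      using B by (auto simp: stable_complements_def)
    show "colourings E (V - B) \<alpha> = card (labellings (colour_rel E) (V - B) (content_mset \<alpha>))"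
      by (simp add: colourings_def)
  next
    fix W assume W: "W \<in> {W. W \<in> stable_complements E V \<and> card V = card W + a}"
    then have sub: "W \<subseteq> V" by (simp add: stable_complements_def)
    then show "V - (V - W) = W" by blast
    have "card (V - W) = a"
      using W sub V by (simp add: card_Diff_subset finite_subset)
    then show "V - W \<in> ?S"
      using W by (auto simp: stable_complements_def)
  qed
  finally show ?thesis .
qed

text \<open>
  Acyclicity of an orientation is expressed as well-foundedness, so that sources are
  minimal elements.
\<close>

definition acyclic_orientations :: "('a \<times> 'a) set \<Rightarrow> 'a set \<Rightarrow> ('a \<times> 'a) set set" where
  "acyclic_orientations E V =
    {D. D \<subseteq> E \<inter> V \<times> V \<and> (\<forall>(u, v)\<in>E \<inter> V \<times> V. (u, v) \<in> D \<longleftrightarrow> (v, u) \<notin> D) \<and> wf D}"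

definition sources :: "('a \<times> 'a) set \<Rightarrow> 'a set \<Rightarrow> 'a set" where
  "sources D V = {v \<in> V. \<forall>u. (u, v) \<notin> D}"

lemma finite_acyclic_orientations [simp]: "finite V \<Longrightarrow> finite (acyclic_orientations E V)"
  by (rule finite_subset[of _ "Pow (V \<times> V)"]) (auto simp: acyclic_orientations_def)

text \<open>If all of \<open>V - W\<close> are sources, every edge between \<open>V - W\<close> and
  \<open>W\<close> is directed into \<open>W\<close>, and stability leaves no edge inside
  \<open>V - W\<close>. The only freedom is an acyclic orientation on \<open>W\<close>.\<close>

lemma acyclic_orientations_remove_sources:
  assumes "sym E" and W: "W \<in> stable_complements E V"
  shows "card {D \<in> acyclic_orientations E V. V - W \<subseteq> sources D V} = card (acyclic_orientations E W)"
proof -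
  have sub: "W \<subseteq> V" and stable: "\<And>x y. x \<in> V - W \<Longrightarrow> y \<in> V - W \<Longrightarrow> (x, y) \<notin> E"
    using W by (auto simp: stable_complements_def)
  have sym: "(v, u) \<in> E" if "(u, v) \<in> E" for u v using \<open>sym E\<close> that by (rule symD)
  let ?N = "E \<inter> (V - W) \<times> W"
  let ?S = "{D \<in> acyclic_orientations E V. V - W \<subseteq> sources D V}"
  have "bij_betw (\<lambda>D. D \<inter> W \<times> W) ?S (acyclic_orientations E W)"
  proof (rule bij_betw_byWitness[where f' = "\<lambda>D. D \<union> ?N"])
    show "\<forall>D\<in>?S. D \<inter> W \<times> W \<union> ?N = D"
    proof
      fix D assume D: "D \<in> ?S"
      then have D1: "D \<subseteq> E \<inter> V \<times> V" and D2: "\<And>u v. (u, v) \<in> E \<inter> V \<times> V \<Longrightarrow> (u, v) \<in> D \<longleftrightarrow> (v, u) \<notin> D"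
        and D3: "\<And>u v. v \<in> V - W \<Longrightarrow> (u, v) \<notin> D"
        by (auto simp: acyclic_orientations_def sources_def)
      show "D \<inter> W \<times> W \<union> ?N = D"
      proof (intro equalityI subrelI)
        fix u v assume "(u, v) \<in> D \<inter> W \<times> W \<union> ?N"
        then show "(u, v) \<in> D" using D2[of u v] D3[of u v] sub D3 by blast
      next
        fix u v assume "(u, v) \<in> D"
        then show "(u, v) \<in> D \<inter> W \<times> W \<union> ?N" using D1 D3[of v u] by blast
      qed
    qed
    show "\<forall>D\<in>acyclic_orientations E W. (D \<union> ?N) \<inter> W \<times> W = D"
      by (auto simp: acyclic_orientations_def)
    show "(\<lambda>D. D \<inter> W \<times> W) ` ?S \<subseteq> acyclic_orientations E W"
      using sub by (auto simp: acyclic_orientations_def intro: wf_subset)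
    show "(\<lambda>D. D \<union> ?N) ` acyclic_orientations E W \<subseteq> ?S"
    proof (rule image_subsetI)
      fix D assume "D \<in> acyclic_orientations E W"
      then have D1: "D \<subseteq> E \<inter> W \<times> W" and D2: "\<And>u v. (u, v) \<in> E \<inter> W \<times> W \<Longrightarrow> (u, v) \<in> D \<longleftrightarrow> (v, u) \<notin> D"
        and D3: "wf D"
        by (auto simp: acyclic_orientations_def)
      have "wf ?N"
        by (auto simp: wf_def)
      \<comment> \<open>No edge of \<open>D\<close> ends where an edge of \<open>?N\<close> starts,
        so adding \<open>?N\<close> creates no infinite descent.\<close>
      then have "wf (?N \<union> D)"
        by (rule wf_Un[OF _ D3]) (use D1 in auto)
      then have "wf (D \<union> ?N)" by (simp add: Un_commute)
      moreover have "(u, v) \<in> D \<union> ?N \<longleftrightarrow> (v, u) \<notin> D \<union> ?N" if "(u, v) \<in> E \<inter> V \<times> V" for u v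
        using that D1 D2[of u v] sym[of u v] stable[of u v] by blast
      ultimately show "D \<union> ?N \<in> ?S"
        using D1 sub by (auto simp: acyclic_orientations_def sources_def)
    qed
  qed
  then show ?thesis by (rule bij_betw_same_card)
qed

text \<open>With B = V - W this is the sum of (-1)^(|B| + 1) over the nonempty subsets of
  \<open>S\<close>; the full alternating sum over a nonempty \<open>S\<close> is 0, and the empty
  set accounts for the 1.\<close>

lemma sum_signs_proper_subsets:
  assumes "finite V" "S \<subseteq> V" "S \<noteq> {}"
  shows "(\<Sum>W | W \<subset> V \<and> V - W \<subseteq> S. (-1) ^ (card V + card W + 1)) = (1 :: rat)"
proof -
  have fin: "finite S" using assms finite_subset by blast
  have "(\<Sum>W | W \<subset> V \<and> V - W \<subseteq> S. (-1) ^ (card V + card W + 1)) =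
      (\<Sum>B\<in>Pow S - {{}}. (-1) ^ (card B + 1) :: rat)"
  proof (rule sum.reindex_bij_witness[where i = "\<lambda>B. V - B" and j = "\<lambda>W. V - W"])
    fix W assume W: "W \<in> {W. W \<subset> V \<and> V - W \<subseteq> S}"
    then show "V - (V - W) = W" "V - W \<in> Pow S - {{}}" by auto
    have "card V = card (V - W) + card W"
      using W assms(1) by (auto simp: card_Diff_subset finite_subset card_mono)
    then show "(-1) ^ (card (V - W) + 1) = ((-1) ^ (card V + card W + 1) :: rat)"
      by (simp add: power_add flip: power_mult_distrib)
  qed (use assms(2) in auto)
  also have "\<dots> = - (\<Sum>B\<in>Pow S - {{}}. (-1) ^ card B)"
    by (simp add: sum_negf)
  also have "(\<Sum>B\<in>Pow S - {{}}. (-1) ^ card B) = (\<Sum>B\<in>Pow S. (-1) ^ card B) - (1 :: rat)"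
    using fin by (simp add: sum_diff)
  also have "(\<Sum>B\<in>Pow S. (-1) ^ card B) = (0 :: rat)"
    using sum_alternating_cancels[of "Pow S" card] card_subsupersets_even_odd[of S "{}"] fin assms(3)
    by (auto simp: Pow_def psubset_eq)
  finally show ?thesis by simp
qed

text \<open>
  Counting the pairs of an acyclic orientation and a nonempty set \<open>V - W\<close> of its sources with signs:
  as there always is a source, each orientation contributes \<open>1\<close>.
\<close>

lemma acyclic_orientations_recursion:
  assumes V: "finite V" "V \<noteq> {}" and E: "sym E"
  shows "rat_of_nat (card (acyclic_orientations E V)) =
    (\<Sum>W | W \<in> stable_complements E V \<and> card W < card V.
      (-1) ^ (card V + card W + 1) * of_nat (card (acyclic_orientations E W)))"
proof -
  let ?O = "acyclic_orientations E V"
  let ?sgn = "\<lambda>W. (-1) ^ (card V + card W + 1) :: rat"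
  have ne: "sources D V \<noteq> {}" if "D \<in> ?O" for D
  proof -
    have "wf D" "D \<subseteq> V \<times> V" using that by (auto simp: acyclic_orientations_def)
    obtain x where "x \<in> V" using V by blast
    then obtain z where "z \<in> V" "\<And>y. (y, z) \<in> D \<Longrightarrow> y \<notin> V"
      using wfE_min[OF \<open>wf D\<close>] by metis
    then show ?thesis using \<open>D \<subseteq> V \<times> V\<close> by (auto simp: sources_def)
  qed
  have "card W < card V \<longleftrightarrow> W \<subset> V" if "W \<in> stable_complements E V" for W
    using that psubset_card_mono[OF V(1), of W] by (auto simp: stable_complements_def)
  then have eq: "{W. W \<in> stable_complements E V \<and> card W < card V} = {W \<in> stable_complements E V. W \<subset> V}"
    by blast
  \<comment> \<open>An edge inside \<open>V - W\<close> points to one of its ends, which is then not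
    a source. This permits the passage from all proper subsets to stable complements.\<close>
  have empty: "{D \<in> ?O. V - W \<subseteq> sources D V} = {}" if W: "W \<subset> V" "W \<notin> stable_complements E V" for W
  proof -
    obtain x y where xy: "x \<in> V - W" "y \<in> V - W" "(x, y) \<in> E"
      using W unfolding stable_complements_def by blast
    then have "(x, y) \<in> D \<or> (y, x) \<in> D" if "D \<in> ?O" for D
      using that by (auto simp: acyclic_orientations_def)
    then show ?thesis using xy by (fastforce simp: sources_def)
  qed
  have "rat_of_nat (card ?O) = (\<Sum>D\<in>?O. \<Sum>W | W \<subset> V \<and> V - W \<subseteq> sources D V. ?sgn W)"
    using sum_signs_proper_subsets[OF V(1) _ ne] by (simp add: sources_def)
  also have "\<dots> = (\<Sum>W | W \<subset> V. \<Sum>D | D \<in> ?O \<and> V - W \<subseteq> sources D V. ?sgn W)"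
    using sum.swap_restrict[of ?O "{W. W \<subset> V}" "\<lambda>D W. ?sgn W" "\<lambda>D W. V - W \<subseteq> sources D V"]
      finite_acyclic_orientations[OF V(1)] finite_subset[of "{W. W \<subset> V}" "Pow V"] V(1)
    by (simp only: mem_Collect_eq finite_Pow_iff) blast
  also have "\<dots> = (\<Sum>W | W \<subset> V. ?sgn W * of_nat (card {D \<in> ?O. V - W \<subseteq> sources D V}))"
    by (simp add: mult.commute)
  also have "\<dots> = (\<Sum>W | W \<in> stable_complements E V \<and> card W < card V.
      ?sgn W * of_nat (card {D \<in> ?O. V - W \<subseteq> sources D V}))"
    unfolding eq using V(1) empty
    by (intro sum.mono_neutral_right) (auto intro: finite_subset[of _ "Pow V"])
  also have "\<dots> = (\<Sum>W | W \<in> stable_complements E V \<and> card W < card V.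
      ?sgn W * of_nat (card (acyclic_orientations E W)))"
    by (rule sum.cong) (auto simp: acyclic_orientations_remove_sources[OF E])
  finally show ?thesis .
qed

text \<open>Both sides satisfy the same recursion over stable complements. Combined with
  \<open>schur_coeff_column\<close>, this gives the combinatorial meaning of the coefficient at
  (1^n).\<close>

lemma alternating_sum_colourings:
  assumes "finite V" "sym E"
  shows "alternating_sum (card V) (\<lambda>\<alpha>. of_nat (colourings E V \<alpha>)) = of_nat (card (acyclic_orientations E V))"
  using assms(1)
proof (induction V rule: finite_psubset_induct)
  case (psubset V)
  show ?case
  proof (cases "V = {}")
    case True
    have "acyclic_orientations E {} = {{}}"
      by (auto simp: acyclic_orientations_def)
    then show ?thesis
      using True by (simp add: alternating_sum_def colourings_def labellings_empty)
  next
    case False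
    have fin: "finite (stable_complements E V)"
      by (rule finite_subset[of _ "Pow V"]) (use psubset.hyps in \<open>auto simp: stable_complements_def\<close>)
    have "alternating_sum (card V) (\<lambda>\<alpha>. of_nat (colourings E V \<alpha>)) =
        (\<Sum>W | W \<in> stable_complements E V \<and> card W < card V.
          (-1) ^ (card V + card W + 1) * alternating_sum (card W) (\<lambda>\<alpha>. of_nat (colourings E W \<alpha>)))"
      using alternating_sum_recursion[where N = "colourings E" and x = V and sz = card, OF fin]
        colourings_snoc[OF psubset.hyps] psubset.hyps False by (simp add: card_gt_0_iff)
    also have "\<dots> = (\<Sum>W | W \<in> stable_complements E V \<and> card W < card V.
          (-1) ^ (card V + card W + 1) * of_nat (card (acyclic_orientations E W)))"
      by (rule sum.cong) (use psubset.IH in \<open>auto simp: stable_complements_def psubset_eq\<close>)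
    finally show ?thesis
      using acyclic_orientations_recursion[OF psubset.hyps False assms(2)] by simp
  qed
qed

text \<open>Direct every edge from its smaller to its larger end; the well-order of the vertices
  makes this well-founded.\<close>

lemma acyclic_orientations_nonempty:
  fixes E :: "('a :: wellorder \<times> 'a) set"
  assumes "sym E" "irrefl E"
  shows "acyclic_orientations E V \<noteq> {}"
proof -
  have "wf {(u, v) \<in> E \<inter> V \<times> V. u < v}"
    by (rule wf_subset[OF wf]) auto
  moreover have "u < v \<or> v < u" if "(u, v) \<in> E" for u v
    using assms(2) that by (metis irrefl_def linorder_neqE)
  ultimately have "{(u, v) \<in> E \<inter> V \<times> V. u < v} \<in> acyclic_orientations E V"
    using assms(1) by (fastforce simp: acyclic_orientations_def dest: symD)
  then show ?thesis by blast
qed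

section \<open>Chromatic symmetric functions\<close>

lemma connected_graphsD:
  assumes "G \<in> connected_graphs n"
  shows "finite (pverts G)" "card (pverts G) = n" "sym (parcs G)" "irrefl (parcs G)"
    "parcs G \<subseteq> pverts G \<times> pverts G"
proof -
  interpret pair_graph G using assms by (simp add: connected_graphs_def)
  show "finite (pverts G)" "sym (parcs G)" "parcs G \<subseteq> pverts G \<times> pverts G"
    using pair_finite_verts pair_sym_arcs in_arcsD1 in_arcsD2 by (auto simp: symmetric_def)
  show "irrefl (parcs G)"
    using pair_no_loops unfolding irrefl_def by force
  show "card (pverts G) = n" using assms by (simp add: connected_graphs_def)
qed

lemma chromatic_sf_eq:
  assumes "parcs G \<subseteq> pverts G \<times> pverts G"
  shows "chromatic_sf G m = of_nat (card (labellings (colour_rel (parcs G)) (pverts G) m))"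
proof -
  have "{\<kappa> \<in> proper_colorings G. monomial_of \<kappa> (pverts G) = m} =
      labellings (colour_rel (parcs G)) (pverts G) m"
    using assms by (auto simp: proper_colorings_def labellings_def colour_rel_def)
  then show ?thesis by (simp add: chromatic_sf_def)
qed

lemma chromatic_sf_content_mset:
  "G \<in> connected_graphs n \<Longrightarrow>
    chromatic_sf G (content_mset \<alpha>) = of_nat (colourings (parcs G) (pverts G) \<alpha>)"
  by (simp add: chromatic_sf_eq connected_graphsD colourings_def)

text \<open>An injective renaming of colours preserves properness, and for an involution the same
  map is the inverse. \<open>pos\<close> keeps the colours positive.\<close>

lemma card_labellings_recolour:
  assumes V: "finite V" and inv: "\<And>x. \<sigma> (\<sigma> x) = x" and pos: "\<And>x. 1 \<le> x \<Longrightarrow> 1 \<le> \<sigma> x"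
  shows "card (labellings (colour_rel E) V (image_mset \<sigma> m)) = card (labellings (colour_rel E) V m)"
proof -
  let ?f = "\<lambda>\<kappa>. restrict (\<sigma> \<circ> \<kappa>) V"
  have inj: "\<sigma> x = \<sigma> y \<longleftrightarrow> x = y" for x y using inv by metis
  have mem: "?f \<kappa> \<in> labellings (colour_rel E) V (image_mset \<sigma> m)"
    if "\<kappa> \<in> labellings (colour_rel E) V m" for \<kappa> m
  proof -
    have "monomial_of (\<sigma> \<circ> \<kappa>) V = image_mset \<sigma> m"
      using that by (auto simp: labellings_def monomial_of_def multiset.map_comp)
    then show ?thesis
      using that V pos by (auto simp: labellings_def colour_rel_def inj PiE_iff)
  qed
  have "image_mset \<sigma> (image_mset \<sigma> m) = m"
    by (simp add: multiset.map_comp o_def inv)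
  moreover have "?f (?f \<kappa>) = \<kappa>" if "\<kappa> \<in> labellings (colour_rel E) V m" for \<kappa> m
    using that by (auto simp: labellings_def PiE_def extensional_def fun_eq_iff inv)
  ultimately have "bij_betw ?f (labellings (colour_rel E) V m) (labellings (colour_rel E) V (image_mset \<sigma> m))"
    using mem mem[of _ "image_mset \<sigma> m"]
    by (intro bij_betw_byWitness[where f' = ?f]) auto
  then show ?thesis by (simp add: bij_betw_same_card)
qed

text \<open>Colours are interchangeable, so in contrast to tableaux a transposition of two colours
  suffices.\<close>

lemma colourings_swap:
  assumes "finite V"
  shows "colourings E V (\<alpha> @ a # b # \<beta>) = colourings E V (\<alpha> @ b # a # \<beta>)"
proof -
  let ?k = "Suc (length \<alpha>)"
  define \<sigma> where "\<sigma> x = (if x = ?k then Suc ?k else if x = Suc ?k then ?k else x)" for x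
  have id: "image_mset \<sigma> (content_mset \<alpha>) = content_mset \<alpha>"
    using set_content_mset[of \<alpha>] by (intro multiset.map_ident_strong) (auto simp: \<sigma>_def)
  have "image_mset \<sigma> (content_mset (\<alpha> @ b # a # \<beta>)) = content_mset (\<alpha> @ a # b # \<beta>)"
  proof (induction \<beta> rule: rev_induct)
    case Nil
    show ?case
      using content_mset_snoc[of "\<alpha> @ [b]" a] content_mset_snoc[of "\<alpha> @ [a]" b]
      by (simp add: content_mset_snoc id) (simp add: \<sigma>_def)
  next
    case (snoc c \<beta>)
    then show ?case
      using content_mset_snoc[of "\<alpha> @ b # a # \<beta>" c] content_mset_snoc[of "\<alpha> @ a # b # \<beta>" c]
      by simp (simp add: \<sigma>_def)
  qed
  then show ?thesis
    using card_labellings_recolour[OF assms, of \<sigma> E "content_mset (\<alpha> @ b # a # \<beta>)"]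
    by (simp add: colourings_def \<sigma>_def split: if_splits)
qed

lemma symmetric_series_chromatic_sf:
  assumes G: "G \<in> connected_graphs n"
  shows "symmetric_series n (chromatic_sf G)"
  unfolding symmetric_series_def
proof (intro conjI allI impI)
  show "0 \<notin># m" "size m = n" if "chromatic_sf G m \<noteq> 0" for m
    using that labellings_eq_empty[of "pverts G" m "colour_rel (parcs G)"] connected_graphsD[OF G]
    by (auto simp: chromatic_sf_eq)
  show "chromatic_sf G (content_mset (\<alpha> @ a # b # \<beta>)) = chromatic_sf G (content_mset (\<alpha> @ b # a # \<beta>))"
    for \<alpha> a b \<beta>
    using connected_graphsD[OF G] colourings_swap by (simp add: chromatic_sf_content_mset[OF G])
qed

lemma schur_coeff_column_chromatic_sf_pos:
  assumes G: "G \<in> connected_graphs n"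
  shows "schur_coeff (replicate n 1) (chromatic_sf G) > 0"
proof -
  note D = connected_graphsD[OF G]
  have "schur_coeff (replicate n 1) (chromatic_sf G) = of_nat (card (acyclic_orientations (parcs G) (pverts G)))"
    using schur_coeff_column[OF symmetric_series_chromatic_sf[OF G]] alternating_sum_colourings[OF D(1,3)]
    by (simp add: chromatic_sf_content_mset[OF G] D(2))
  moreover have "card (acyclic_orientations (parcs G) (pverts G)) > 0"
    using acyclic_orientations_nonempty[OF D(3,4)] D(1) by (simp add: card_gt_0_iff)
  ultimately show ?thesis by simp
qed

text \<open>When all colours are distinct the edges impose nothing: the last colour may go to any
  vertex, as single vertices are stable in a loopless graph. The value fixes the scale when two
  chromatic functions are proportional.\<close>

lemma colourings_distinct:
  assumes "finite V" "card V = n" "irrefl E"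
  shows "colourings E V (replicate n 1) = fact n"
  using assms
proof (induction n arbitrary: V)
  case 0
  then show ?case by (simp add: colourings_def labellings_empty)
next
  case (Suc n)
  have eq: "{W. W \<in> stable_complements E V \<and> card V = card W + 1} = (\<lambda>x. V - {x}) ` V"
  proof (intro equalityI subsetI)
    fix W assume W: "W \<in> {W. W \<in> stable_complements E V \<and> card V = card W + 1}"
    then have "card (V - W) = 1"
      using Suc.prems by (auto simp: stable_complements_def card_Diff_subset finite_subset)
    then obtain x where "V - W = {x}" by (metis card_1_singletonE)
    then have "x \<in> V" "W = V - {x}" using W by (auto simp: stable_complements_def)
    then show "W \<in> (\<lambda>x. V - {x}) ` V" by blast
  next
    fix W assume "W \<in> (\<lambda>x. V - {x}) ` V"
    then show "W \<in> {W. W \<in> stable_complements E V \<and> card V = card W + 1}"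
      using Suc.prems by (auto simp: stable_complements_def irrefl_def)
  qed
  have "colourings E V (replicate (Suc n) 1) = colourings E V (replicate n 1 @ [1])"
    by (simp only: replicate_append_same replicate_Suc)
  also have "\<dots> = (\<Sum>W\<in>(\<lambda>x. V - {x}) ` V. colourings E W (replicate n 1))"
    using Suc.prems(1) by (simp only: colourings_snoc eq)
  also have "\<dots> = (\<Sum>W\<in>(\<lambda>x. V - {x}) ` V. fact n)"
    using Suc.prems by (intro sum.cong refl Suc.IH) auto
  also have "\<dots> = card ((\<lambda>x. V - {x}) ` V) * fact n" by simp
  also have "card ((\<lambda>x. V - {x}) ` V) = Suc n"
    using Suc.prems by (subst card_image) (auto intro: inj_onI)
  finally show ?case by simp
qed

lemma chromatic_sf_distinct:
  "G \<in> connected_graphs n \<Longrightarrow> chromatic_sf G (content_mset (replicate n 1)) = fact n"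
  by (simp add: chromatic_sf_content_mset colourings_distinct connected_graphsD del: One_nat_def)

definition normalized_coeff :: "nat \<Rightarrow> 'a pair_pre_digraph \<Rightarrow> nat list \<Rightarrow> rat" where
  "normalized_coeff n G \<mu> =
    schur_coeff \<mu> (chromatic_sf G) / schur_coeff (replicate n 1) (chromatic_sf G)"

lemma schur_positive_X_s_iff:
  assumes G: "G \<in> connected_graphs n" and H: "H \<in> connected_graphs n"
  shows "schur_positive (X_s n G H) \<longleftrightarrow>
    (\<forall>\<mu>\<in>partitions_of n. normalized_coeff n H \<mu> \<le> normalized_coeff n G \<mu>)"
proof -
  let ?a = "\<lambda>G. schur_coeff (replicate n 1) (chromatic_sf G)"
  have pos: "?a G > 0" "?a H > 0"
    using G H schur_coeff_column_chromatic_sf_pos by blast+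
  have coeff: "schur_coeff \<mu> (X_s n G H) =
      schur_coeff \<mu> (chromatic_sf G) - ?a G / ?a H * schur_coeff \<mu> (chromatic_sf H)" for \<mu>
    unfolding X_s_def
    by (rule schur_coeff_diff) (use G H symmetric_series_chromatic_sf in blast)+
  have "schur_coeff \<mu> (X_s n G H) \<ge> 0 \<longleftrightarrow> normalized_coeff n H \<mu> \<le> normalized_coeff n G \<mu>" for \<mu>
    unfolding coeff normalized_coeff_def using pos by (simp add: field_simps)
  \<comment> \<open>\<open>schur_positive\<close> ranges over partitions of every size; outside size
    \<open>n\<close> both sides vanish.\<close>
  moreover have "normalized_coeff n F \<mu> = 0" if "F \<in> connected_graphs n" "\<mu> \<notin> partitions_of n" for F :: "nat pair_pre_digraph" and \<mu>
    using schur_coeff_eq_0[OF symmetric_series_chromatic_sf that(2)] that(1)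
    by (simp add: normalized_coeff_def)
  ultimately show ?thesis
    unfolding schur_positive_def using G H by (metis (no_types, lifting) mem_Collect_eq order_refl partitions_of_def)
qed

lemma chromatic_sf_eqI:
  assumes G: "G \<in> connected_graphs n" and H: "H \<in> connected_graphs n"
    and eq: "\<And>\<mu>. \<mu> \<in> partitions_of n \<Longrightarrow> normalized_coeff n G \<mu> = normalized_coeff n H \<mu>"
  shows "chromatic_sf G = chromatic_sf H"
proof -
  let ?a = "\<lambda>G. schur_coeff (replicate n 1) (chromatic_sf G)"
  have pos: "?a G > 0" "?a H > 0"
    using G H schur_coeff_column_chromatic_sf_pos by blast+
  have expand: "chromatic_sf F m / ?a F = (\<Sum>\<mu>\<in>partitions_of n. normalized_coeff n F \<mu> * schur \<mu> m)"
    if "F \<in> connected_graphs n" for F m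
    by (subst schur_coeff_expansion[OF symmetric_series_chromatic_sf[OF that]])
      (simp add: sum_divide_distrib normalized_coeff_def)
  have ratio: "chromatic_sf G m / ?a G = chromatic_sf H m / ?a H" for m
    unfolding expand[OF G] expand[OF H] by (simp add: eq)
  have "?a G = ?a H"
    using ratio[of "content_mset (replicate n 1)"] pos
    by (simp add: chromatic_sf_distinct[OF G] chromatic_sf_distinct[OF H] del: One_nat_def)
  then show ?thesis
    using ratio pos by (intro ext) simp
qed

section \<open>The partial order\<close>

lemma chromatic_class:
  assumes "A \<in> connected_graphs n // chromatic_equiv n"
  shows "\<exists>G. G \<in> A" and "G \<in> A \<Longrightarrow> G \<in> connected_graphs n"
    and "G \<in> A \<Longrightarrow> H \<in> A \<Longrightarrow> chromatic_sf G = chromatic_sf H"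
  using assms by (auto simp: quotient_def chromatic_equiv_def)

lemma chromatic_class_eqI:
  assumes "A \<in> connected_graphs n // chromatic_equiv n" "B \<in> connected_graphs n // chromatic_equiv n"
    and "G \<in> A" "H \<in> B" "chromatic_sf G = chromatic_sf H"
  shows "A = B"
  using assms by (auto simp: quotient_def chromatic_equiv_def)

lemma S_poset_le_iff:
  assumes A: "A \<in> carrier (S_poset n)" and B: "B \<in> carrier (S_poset n)" and G: "G \<in> A" and H: "H \<in> B"
  shows "le (S_poset n) A B \<longleftrightarrow>
    (\<forall>\<mu>\<in>partitions_of n. normalized_coeff n G \<mu> \<le> normalized_coeff n H \<mu>)"
proof -
  have carrier: "A \<in> connected_graphs n // chromatic_equiv n" "B \<in> connected_graphs n // chromatic_equiv n"
    using A B by (auto simp: S_poset_def)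
  have "normalized_coeff n G' = normalized_coeff n G" if "G' \<in> A" for G'
    by (rule ext) (simp add: normalized_coeff_def chromatic_class(3)[OF carrier(1) that G])
  moreover have "normalized_coeff n H' = normalized_coeff n H" if "H' \<in> B" for H'
    by (rule ext) (simp add: normalized_coeff_def chromatic_class(3)[OF carrier(2) that H])
  ultimately have "schur_positive (X_s n H' G') \<longleftrightarrow>
      (\<forall>\<mu>\<in>partitions_of n. normalized_coeff n G \<mu> \<le> normalized_coeff n H \<mu>)"
    if "G' \<in> A" "H' \<in> B" for G' H'
    using schur_positive_X_s_iff[of H' n G'] chromatic_class(2)[OF carrier(1)] chromatic_class(2)[OF carrier(2)] that
    by simp
  then show ?thesis
    using G H by (auto simp: S_poset_def)
qed

lemma partial_order_S_poset: "partial_order (S_poset n)"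
proof -
  have rep: "\<exists>G. G \<in> A" if "A \<in> carrier (S_poset n)" for A
    using that chromatic_class(1)[of A n] by (simp add: S_poset_def)
  have eq: "eq (S_poset n) = (=)"
    by (simp add: S_poset_def)
  show ?thesis
  proof unfold_locales
    show "le (S_poset n) A A" if "A \<in> carrier (S_poset n)" for A
      using rep[OF that] S_poset_le_iff[OF that that] by auto
    show "A .=\<^bsub>S_poset n\<^esub> B"
      if le: "le (S_poset n) A B" "le (S_poset n) B A" and AB: "A \<in> carrier (S_poset n)" "B \<in> carrier (S_poset n)" for A B
    proof -
      obtain G H where GH: "G \<in> A" "H \<in> B" using rep AB by blast
      have c: "A \<in> connected_graphs n // chromatic_equiv n" "B \<in> connected_graphs n // chromatic_equiv n"
        using AB by (auto simp: S_poset_def)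
      have "normalized_coeff n G \<mu> = normalized_coeff n H \<mu>" if "\<mu> \<in> partitions_of n" for \<mu>
        using le that
        unfolding S_poset_le_iff[OF AB GH] S_poset_le_iff[OF AB(2,1) GH(2,1)] by (meson antisym)
      then have "chromatic_sf G = chromatic_sf H"
        using chromatic_sf_eqI chromatic_class(2)[OF c(1) GH(1)] chromatic_class(2)[OF c(2) GH(2)] by blast
      then show ?thesis
        using chromatic_class_eqI[OF c GH] by (simp add: eq)
    qed
    show "le (S_poset n) A C"
      if le: "le (S_poset n) A B" "le (S_poset n) B C"
        and ABC: "A \<in> carrier (S_poset n)" "B \<in> carrier (S_poset n)" "C \<in> carrier (S_poset n)" for A B C
    proof -
      obtain G where G: "G \<in> A" using rep[OF ABC(1)] by blast
      obtain H where H: "H \<in> B" using rep[OF ABC(2)] by blast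
      obtain K where K: "K \<in> C" using rep[OF ABC(3)] by blast
      show ?thesis
        using le unfolding S_poset_le_iff[OF ABC(1,2) G H] S_poset_le_iff[OF ABC(2,3) H K]
          S_poset_le_iff[OF ABC(1,3) G K] by (meson order_trans)
    qed
  qed (simp_all add: eq)
qed

section \<open>Complete graphs and stars\<close>

text \<open>Any two vertices are joined by a walk through the vertex 0.\<close>

lemma connected_graphs_hubI:
  fixes n :: nat
  assumes n: "0 < n" and E: "E \<subseteq> {..<n} \<times> {..<n}" "sym E" "irrefl E"
    and hub: "\<And>v. 0 < v \<Longrightarrow> v < n \<Longrightarrow> (0, v) \<in> E"
  shows "\<lparr>pverts = {..<n}, parcs = E\<rparr> \<in> connected_graphs n"
proof -
  let ?G = "\<lparr>pverts = {..<n}, parcs = E\<rparr>"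
  have "finite E" using E(1) finite_subset by blast
  then have G: "pair_graph ?G"
    using E by unfold_locales (auto simp: symmetric_def irrefl_def)
  \<comment> \<open>Connectedness is defined as strong connectedness of the symmetric closure, which
    adds nothing to a symmetric \<open>E\<close>.\<close>
  have sym: "parcs (mk_symmetric (with_proj ?G)) = E"
    using E(2) by (auto simp: mk_symmetric_def dest: symD)
  have verts: "pverts (mk_symmetric (with_proj ?G)) = {..<n}"
    by (simp add: mk_symmetric_def)
  have from0: "(0, v) \<in> rtrancl_on {..<n} E" if "v < n" for v
  proof (cases "v = 0")
    case False
    then show ?thesis
      using hub[of v] that n rtrancl_on_into_rtrancl_on[of 0 0 "{..<n}" E v] by simp
  qed (use n in auto)
  have to0: "(v, 0) \<in> rtrancl_on {..<n} E" if "v < n" for v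
  proof (cases "v = 0")
    case False
    then have "(v, 0) \<in> E" using hub[of v] that E(2) by (auto dest: symD)
    then show ?thesis
      using that n rtrancl_on_into_rtrancl_on[of v v "{..<n}" E 0] by simp
  qed (use n in auto)
  have "Digraph_Component.connected (with_proj ?G)"
    unfolding Digraph_Component.connected_def strongly_connected_def reachable_def
    using n rtrancl_on_trans[OF to0 from0] by (auto simp: sym verts)
  then show ?thesis
    using G by (simp add: connected_graphs_def)
qed

definition complete_graph :: "nat \<Rightarrow> nat pair_pre_digraph" where
  "complete_graph n = \<lparr>pverts = {..<n}, parcs = {(u, v). u < n \<and> v < n \<and> u \<noteq> v}\<rparr>"

definition star_graph :: "nat \<Rightarrow> nat pair_pre_digraph" where
  "star_graph n = \<lparr>pverts = {..<n}, parcs = {(u, v). u < n \<and> v < n \<and> u \<noteq> v \<and> (u = 0 \<or> v = 0)}\<rparr>"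

lemma complete_graph_connected: "0 < n \<Longrightarrow> complete_graph n \<in> connected_graphs n"
  unfolding complete_graph_def
  by (rule connected_graphs_hubI) (auto simp: sym_def irrefl_def)

lemma star_graph_connected: "0 < n \<Longrightarrow> star_graph n \<in> connected_graphs n"
  unfolding star_graph_def
  by (rule connected_graphs_hubI) (auto simp: sym_def irrefl_def)

section \<open>Vanishing coefficients and the two-row test\<close>

lemma content_mset_pair: "content_mset [a, b] = replicate_mset a 1 + replicate_mset b 2"
  by (simp add: content_mset_def numeral_2_eq_2)

lemma count_monomial_of: "finite A \<Longrightarrow> count (monomial_of T A) x = card {a \<in> A. T a = x}"
  unfolding monomial_of_def by (rule count_image_mset_eq_card_vimage)

text \<open>An injective labelling uses every label at most once, which for a partition as content
  forces (1^n). This applies to one-column tableaux and to colourings of the complete graph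
  alike.\<close>

lemma labellings_injective:
  assumes \<mu>: "\<mu> \<in> partitions_of n" "\<mu> \<noteq> replicate n 1" and A: "finite A"
    and inj: "\<And>T. T \<in> labellings C A (content_mset \<mu>) \<Longrightarrow> inj_on T A"
  shows "labellings C A (content_mset \<mu>) = {}"
proof (rule ccontr)
  assume "labellings C A (content_mset \<mu>) \<noteq> {}"
  then obtain T where T: "T \<in> labellings C A (content_mset \<mu>)" by blast
  have "count (content_mset \<mu>) x \<le> 1" for x
  proof -
    have "card {a \<in> A. T a = x} \<le> 1"
      using A inj_onD[OF inj[OF T]] by (auto simp: card_le_Suc0_iff_eq)
    moreover have "content_mset \<mu> = monomial_of T A" using T by (simp add: labellings_def)
    ultimately show ?thesis using A by (simp add: count_monomial_of)
  qed
  then show False using partition_eq_replicate_1 \<mu> by blast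
qed

lemma schur_column_eq_0:
  assumes "\<mu> \<in> partitions_of n" "\<mu> \<noteq> replicate n 1"
  shows "schur (replicate n 1) (content_mset \<mu>) = 0"
proof -
  have "inj_on T (young_diagram (replicate n 1))"
    if "T \<in> labellings tableau_rel (young_diagram (replicate n 1)) (content_mset \<mu>)" for T
  proof (rule inj_onI)
    fix x y assume *: "x \<in> young_diagram (replicate n 1)" "y \<in> young_diagram (replicate n 1)" "T x = T y"
    have "tableau_rel x y (T x) (T y)" "tableau_rel y x (T y) (T x)"
      using that *(1,2) by (simp_all add: labellings_def)
    moreover have "snd x = 0" "snd y = 0"
      using *(1,2) by (auto simp: young_diagram_def)
    ultimately show "x = y"
      using *(3) by (auto simp: tableau_rel_def prod_eq_iff)
  qed
  then show ?thesis
    using labellings_injective[OF assms finite_young_diagram] by (simp add: schur_eq del: One_nat_def)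
qed

lemma chromatic_sf_complete_graph_eq_0:
  assumes "\<mu> \<in> partitions_of n" "\<mu> \<noteq> replicate n 1" "0 < n"
  shows "chromatic_sf (complete_graph n) (content_mset \<mu>) = 0"
proof -
  let ?G = "complete_graph n"
  have "inj_on T (pverts ?G)" if "T \<in> labellings (colour_rel (parcs ?G)) (pverts ?G) (content_mset \<mu>)" for T
    using that by (auto simp: labellings_def colour_rel_def complete_graph_def intro!: inj_onI)
  moreover note D = connected_graphsD[OF complete_graph_connected[OF assms(3)]]
  ultimately have "labellings (colour_rel (parcs ?G)) (pverts ?G) (content_mset \<mu>) = {}"
    by (intro labellings_injective[OF assms(1,2)]) auto
  then show ?thesis using D(5) by (simp add: chromatic_sf_eq)
qed

text \<open>Both the chromatic function of the complete graph and the one-column Schur function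
  vanish at all partitions other than (1^n), so the former is a multiple of the latter.\<close>

lemma schur_coeff_complete_graph:
  assumes "0 < n" "\<mu> \<noteq> replicate n 1"
  shows "schur_coeff \<mu> (chromatic_sf (complete_graph n)) = 0"
proof -
  let ?X = "chromatic_sf (complete_graph n)" and ?e = "replicate n 1"
  note e = replicate_1_partition[of n]
  have "is_partition ?e" using e by (simp add: partitions_of_def)
  have sym: "symmetric_series n ?X"
    using symmetric_series_chromatic_sf complete_graph_connected assms(1) by blast
  have "(\<lambda>m. ?X m - ?X (content_mset ?e) * schur ?e m) = (\<lambda>_. 0)"
  proof (rule symmetric_series_eqI[where n = n])
    show "symmetric_series n (\<lambda>m. ?X m - ?X (content_mset ?e) * schur ?e m)"
      by (rule symmetric_series_diff[OF sym symmetric_series_schur[OF e]])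
    show "?X (content_mset \<nu>) - ?X (content_mset ?e) * schur ?e (content_mset \<nu>) = 0"
      if "\<nu> \<in> partitions_of n" for \<nu>
    proof (cases "\<nu> = ?e")
      case True
      then show ?thesis using schur_self[OF \<open>is_partition ?e\<close>] by (simp del: One_nat_def)
    next
      case False
      then show ?thesis
        using that assms(1) chromatic_sf_complete_graph_eq_0 schur_column_eq_0 by (simp del: One_nat_def)
    qed
  qed (rule symmetric_series_0)
  then have "?X m = ?X (content_mset ?e) * schur ?e m" for m
    unfolding fun_eq_iff right_minus_eq by blast
  also have "?X (content_mset ?e) * schur ?e m =
      (\<Sum>\<nu>\<in>partitions_of n. (if \<nu> = ?e then ?X (content_mset ?e) else 0) * schur \<nu> m)" for m
    using e by (simp add: if_distrib[of "\<lambda>x. x * _"] del: One_nat_def cong: if_cong)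
  finally have "?X m = (\<Sum>\<nu>\<in>partitions_of n. (if \<nu> = ?e then ?X (content_mset ?e) else 0) * schur \<nu> m)" for m .
  from schur_coeff_unique[OF this, of \<mu>] show ?thesis using assms(2) by simp
qed

text \<open>
  Only the shapes \<open>(a + 2)\<close> and \<open>(a + 1, 1)\<close> have a tableau of content \<open>[a + 1, 1]\<close>, and in both of
  them a \<open>1\<close> of the first row can be replaced by a \<open>2\<close>.
\<close>

lemma schur_two_row_content:
  assumes \<mu>: "is_partition \<mu>" and a: "1 \<le> a" and nz: "schur \<mu> (content_mset [a + 1, 1]) \<noteq> 0"
  shows "schur \<mu> (content_mset [a, 2]) > 0"
proof -
  define f where "f = row_lengths \<mu>"
  have f: "shape f" using \<mu> by (simp add: f_def)
  have zero: "shape (\<lambda>_. 0)" by (auto simp: shape_def antimono_def)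
  have "(\<Sum>g | strip f g \<and> card (diagram f) = card (diagram g) + 1. tableaux g [a + 1]) \<noteq> 0"
    using nz tableaux_snoc[OF f, of "[a + 1]" 1] by (simp add: schur_content_mset f_def)
  then obtain g where g: "strip f g" "card (diagram f) = card (diagram g) + 1" "tableaux g [a + 1] \<noteq> 0"
    by (rule sum.not_neutral_contains_not_neutral) blast
  have sg: "shape g" using strip_shape g(1) f by blast
  have "(\<Sum>h | strip g h \<and> card (diagram g) = card (diagram h) + (a + 1). tableaux h []) \<noteq> 0"
    using g(3) tableaux_snoc[OF sg, of "[]" "a + 1"] by simp
  then obtain h where h: "strip g h" "card (diagram g) = card (diagram h) + (a + 1)" "tableaux h [] \<noteq> 0"
    by (rule sum.not_neutral_contains_not_neutral) blast
  have "h = (\<lambda>_. 0)"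
    using h(3) tableaux_Nil[OF strip_shape[OF h(1) sg]] by (auto split: if_splits)
  then have gS: "g (Suc i) = 0" for i
    using h(1) by (simp add: strip_def)
  have cg: "card (diagram g) = a + 1"
    using h(2) \<open>h = (\<lambda>_. 0)\<close> by (simp add: diagram_def)
  have "card (diagram g) = (\<Sum>i<1. g i)"
    by (rule card_diagram) (metis gS Suc_le_D One_nat_def)
  then have g0: "g 0 = a + 1" using cg by simp
  \<comment> \<open>Row 1 of \<open>g\<close> is empty, so row 1 of \<open>f\<close> lies in the
    strip of the entries 2, which has a single cell.\<close>
  have f1: "f 1 \<le> 1"
  proof (rule ccontr)
    assume "\<not> f 1 \<le> 1"
    then have "{(1, 0), (1, 1)} \<subseteq> diagram f - diagram g"
      using gS[of 0] by auto
    then have "card {(1::nat, 0::nat), (1, 1)} \<le> card (diagram f - diagram g)"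
      using f by (intro card_mono) auto
    moreover have "card (diagram f - diagram g) = 1"
      using g(2) strip_diagram_subset[OF g(1)] sg by (simp add: card_Diff_subset)
    ultimately show False by simp
  qed
  \<comment> \<open>The row of entries 1 is shortened from \<open>a + 1\<close> to \<open>a\<close>
    cells, which leaves two cells for the entry 2. They form a horizontal strip since
    \<open>f 1\<close> is at most 1 and hence at most \<open>a\<close>.\<close>
  define k where "k i = (if i = 0 then a else 0)" for i :: nat
  have ck: "card (diagram k) = a"
    using card_diagram[of 1 k] by (simp add: k_def)
  have fk: "strip f k"
    unfolding strip_def
  proof
    fix i
    have "f (Suc i) \<le> g i" "g i \<le> f i" using g(1) by (auto simp: strip_def)
    then show "f (Suc i) \<le> k i \<and> k i \<le> f i"
      using f1 a g0 gS by (cases i) (auto simp: k_def)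
  qed
  have sk: "shape k" using strip_shape fk f by blast
  have "strip k (\<lambda>_. 0)" by (simp add: strip_def k_def)
  moreover have "card (diagram (\<lambda>_. 0)) = 0" by (simp add: diagram_def)
  ultimately have "tableaux k ([] @ [a]) > 0"
    unfolding tableaux_snoc[OF sk] using finite_strips[OF sk] tableaux_Nil[OF zero]
    by (intro sum_pos2[of _ "\<lambda>_. 0"]) (auto simp: ck)
  then have "tableaux f ([a] @ [2]) > 0"
    unfolding tableaux_snoc[OF f] using finite_strips[OF f] fk g(2) cg ck
    by (intro sum_pos2[of _ k]) auto
  then show ?thesis
    by (simp add: schur_content_mset f_def)
qed

text \<open>Some Schur function with nonzero, hence positive, coefficient contributes to the first
  monomial. It contributes to the second one too, where nonnegativity excludes cancellation.\<close>

lemma nonnegative_coeffs_two_row: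
  assumes F: "symmetric_series n F" and nonneg: "\<And>\<mu>. \<mu> \<in> partitions_of n \<Longrightarrow> schur_coeff \<mu> F \<ge> 0"
    and a: "1 \<le> a" and nz: "F (content_mset [a + 1, 1]) \<noteq> 0"
  shows "F (content_mset [a, 2]) > 0"
proof -
  have "(\<Sum>\<mu>\<in>partitions_of n. schur_coeff \<mu> F * schur \<mu> (content_mset [a + 1, 1])) \<noteq> 0"
    using nz schur_coeff_expansion[OF F] by metis
  then obtain \<mu> where \<mu>: "\<mu> \<in> partitions_of n" "schur_coeff \<mu> F \<noteq> 0" "schur \<mu> (content_mset [a + 1, 1]) \<noteq> 0"
    by (metis (no_types, lifting) sum.neutral mult_eq_0_iff)
  have "schur \<mu> (content_mset [a, 2]) > 0"
    using schur_two_row_content[OF _ a \<mu>(3)] \<mu>(1) by (simp add: partitions_of_def)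
  moreover have "schur_coeff \<mu> F > 0" using nonneg[OF \<mu>(1)] \<mu>(2) by simp
  ultimately have "(\<Sum>\<mu>\<in>partitions_of n. schur_coeff \<mu> F * schur \<mu> (content_mset [a, 2])) > 0"
    using \<mu>(1) nonneg by (intro sum_pos2[of _ \<mu>]) (auto simp: schur_def)
  then show ?thesis using schur_coeff_expansion[OF F] by metis
qed

lemma star_graph_not_schur_positive:
  assumes "4 \<le> n"
  shows "\<exists>\<mu>\<in>partitions_of n. schur_coeff \<mu> (chromatic_sf (star_graph n)) < 0"
proof (rule ccontr)
  assume neg: "\<not> ?thesis"
  let ?G = "star_graph n"
  define a where "a = n - 2"
  have n: "n = a + 2" and a: "2 \<le> a" using assms by (simp_all add: a_def)
  have G: "?G \<in> connected_graphs n" using star_graph_connected assms by simp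
  have V: "pverts ?G = {..<n}" by (simp add: star_graph_def)
  let ?\<kappa> = "\<lambda>v\<in>{..<n}. if v = 0 then 2 else 1 :: nat"
  have "monomial_of ?\<kappa> {..<n} = content_mset [a + 1, 1]"
  proof (rule multiset_eqI)
    fix x
    have "{v \<in> {..<n}. ?\<kappa> v = x} = (if x = 1 then {1..<n} else if x = 2 then {0} else {})"
      using n by (auto split: if_splits)
    then have "count (monomial_of ?\<kappa> {..<n}) x = card (if x = 1 then {1..<n} else if x = 2 then {0} else {})"
      by (simp only: count_monomial_of finite_lessThan)
    then show "count (monomial_of ?\<kappa> {..<n}) x = count (content_mset [a + 1, 1]) x"
      using n by (auto simp: content_mset_pair)
  qed
  then have "?\<kappa> \<in> labellings (colour_rel (parcs ?G)) (pverts ?G) (content_mset [a + 1, 1])"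
    by (auto simp: labellings_def V colour_rel_def star_graph_def)
  then have "chromatic_sf ?G (content_mset [a + 1, 1]) \<noteq> 0"
    using connected_graphsD[OF G] finite_labellings[of "pverts ?G"] by (auto simp: chromatic_sf_eq)
  moreover have "schur_coeff \<mu> (chromatic_sf ?G) \<ge> 0" if "\<mu> \<in> partitions_of n" for \<mu>
    using neg that by (meson not_less)
  ultimately have "chromatic_sf ?G (content_mset [a, 2]) > 0"
    using nonnegative_coeffs_two_row[OF symmetric_series_chromatic_sf[OF G]] a by simp
  then have "labellings (colour_rel (parcs ?G)) (pverts ?G) (content_mset [a, 2]) \<noteq> {}"
    using connected_graphsD[OF G] by (auto simp: chromatic_sf_eq)
  then obtain \<kappa> where \<kappa>: "\<kappa> \<in> labellings (colour_rel (parcs ?G)) (pverts ?G) (content_mset [a, 2])"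
    by blast
  \<comment> \<open>The centre is adjacent to all other vertices, so its colour is used exactly
    once.\<close>
  have "\<kappa> v \<noteq> \<kappa> 0" if "0 < v" "v < n" for v
    using \<kappa> that by (auto simp: labellings_def colour_rel_def star_graph_def)
  then have "{v \<in> {..<n}. \<kappa> v = \<kappa> 0} = {0}"
    using n by (auto intro: gr0I)
  then have "count (content_mset [a, 2]) (\<kappa> 0) = 1"
    using \<kappa> count_monomial_of[of "{..<n}" \<kappa> "\<kappa> 0"] by (simp add: labellings_def V)
  \<comment> \<open>Every multiplicity in this content is \<open>a\<close>, 2 or 0. None equals 1,
    because \<open>a\<close> is at least 2; this is where n >= 4 enters.\<close>
  then show False
    using a by (simp add: content_mset_pair split: if_splits)
qed

section \<open>The pair without a common lower bound\<close>

lemma below_complete_graph: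
  assumes G: "G \<in> connected_graphs n" and n: "0 < n"
    and le: "\<And>\<mu>. \<mu> \<in> partitions_of n \<Longrightarrow> normalized_coeff n G \<mu> \<le> normalized_coeff n (complete_graph n) \<mu>"
    and \<nu>: "\<nu> \<in> partitions_of n" "\<nu> \<noteq> replicate n 1"
  shows "schur_coeff \<nu> (chromatic_sf G) = 0"
proof (rule ccontr)
  assume nz: "schur_coeff \<nu> (chromatic_sf G) \<noteq> 0"
  have nonpos: "schur_coeff \<mu> (chromatic_sf G) \<le> 0" if "\<mu> \<in> partitions_of n" "\<mu> \<noteq> replicate n 1" for \<mu>
    using le[OF that(1)] schur_coeff_complete_graph[OF n that(2)] schur_coeff_column_chromatic_sf_pos[OF G]
    by (simp add: normalized_coeff_def divide_le_0_iff)
  have "(\<Sum>\<mu>\<in>partitions_of n. schur_coeff \<mu> (chromatic_sf G) * schur \<mu> (content_mset \<nu>)) \<ge> 0"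
    using schur_coeff_expansion[OF symmetric_series_chromatic_sf[OF G], of "content_mset \<nu>"]
    by (simp add: chromatic_sf_content_mset[OF G])
  \<comment> \<open>The strictly negative term is the one of \<open>\<nu>\<close> itself, whose
    Schur function has coefficient 1 at this monomial.\<close>
  moreover have "(\<Sum>\<mu>\<in>partitions_of n. schur_coeff \<mu> (chromatic_sf G) * schur \<mu> (content_mset \<nu>)) < (\<Sum>\<mu>\<in>partitions_of n. 0)"
  proof (rule sum_strict_mono_ex1)
    have "schur_coeff \<nu> (chromatic_sf G) * schur \<nu> (content_mset \<nu>) < 0"
      using nz nonpos[OF \<nu>] \<nu>(1) by (simp add: partitions_of_def)
    then show "\<exists>\<mu>\<in>partitions_of n. schur_coeff \<mu> (chromatic_sf G) * schur \<mu> (content_mset \<nu>) < 0"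
      using \<nu>(1) by blast
    show "\<forall>\<mu>\<in>partitions_of n. schur_coeff \<mu> (chromatic_sf G) * schur \<mu> (content_mset \<nu>) \<le> 0"
    proof
      fix \<mu> assume \<mu>: "\<mu> \<in> partitions_of n"
      show "schur_coeff \<mu> (chromatic_sf G) * schur \<mu> (content_mset \<nu>) \<le> 0"
      proof (cases "\<mu> = replicate n 1")
        case True
        then show ?thesis using schur_column_eq_0[OF \<nu>] by (simp del: One_nat_def)
      next
        case False
        then show ?thesis
          using nonpos[OF \<mu>] by (simp add: schur_def mult_nonpos_nonneg)
      qed
    qed
  qed simp
  ultimately show False by simp
qed

theorem corollary4p13:
  fixes n :: nat
  assumes "n \<ge> 4"
  shows "partial_order (S_poset n) \<and> \<not> lattice (S_poset n)"
proof
  show "partial_order (S_poset n)" by (rule partial_order_S_poset)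
  show "\<not> lattice (S_poset n)"
  proof
    assume "lattice (S_poset n)"
    then interpret lattice "S_poset n" .
    have n: "0 < n" using assms by simp
    let ?K = "chromatic_equiv n `` {complete_graph n}" and ?S = "chromatic_equiv n `` {star_graph n}"
    have mem: "complete_graph n \<in> ?K" "star_graph n \<in> ?S"
      using complete_graph_connected[OF n] star_graph_connected[OF n] by (auto simp: chromatic_equiv_def)
    have carrier: "?K \<in> carrier (S_poset n)" "?S \<in> carrier (S_poset n)"
      using complete_graph_connected[OF n] star_graph_connected[OF n] by (auto simp: S_poset_def quotientI)
    \<comment> \<open>Only existence of a lower bound is taken from the meet; its maximality does
      not matter.\<close>
    then obtain A where "greatest (S_poset n) A (Lower (S_poset n) {?K, ?S})"
      using inf_of_two_exists by blast
    then have A: "A \<in> carrier (S_poset n)" "le (S_poset n) A ?K" "le (S_poset n) A ?S"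
      using carrier by (auto simp: greatest_def Lower_def)
    obtain G where G: "G \<in> A" "G \<in> connected_graphs n"
      using A(1) chromatic_class(1,2)[of A n] by (auto simp: S_poset_def)
    obtain \<mu> where \<mu>: "\<mu> \<in> partitions_of n" "schur_coeff \<mu> (chromatic_sf (star_graph n)) < 0"
      using star_graph_not_schur_positive[OF assms] by blast
    note pos = schur_coeff_column_chromatic_sf_pos[OF star_graph_connected[OF n]]
    \<comment> \<open>The coefficient of the star at (1^n) is positive, so the negative one sits
      elsewhere, where that of \<open>G\<close> vanishes.\<close>
    have "\<mu> \<noteq> replicate n 1" using \<mu>(2) pos by (auto simp del: One_nat_def)
    then have "schur_coeff \<mu> (chromatic_sf G) = 0"
      using below_complete_graph[OF G(2) n _ \<mu>(1)] A(2) S_poset_le_iff[OF A(1) carrier(1) G(1) mem(1)] by blast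
    then have "0 \<le> normalized_coeff n (star_graph n) \<mu>"
      using A(3) \<mu>(1) S_poset_le_iff[OF A(1) carrier(2) G(1) mem(2)] by (force simp: normalized_coeff_def)
    then show False
      using \<mu>(2) pos by (simp add: normalized_coeff_def zero_le_divide_iff)
  qed
qed

end
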